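(* Let $\gamma \in (0,1)$ and let $\mu$ be a nontrivial (i.e. not finitely supported) probability measure on the unit circle $\partial\mathbb{D}$ whose Verblunsky coefficients $\{\alpha_n\}_{n\ge 0}$ satisfy $$\sum_{n=0}^\infty n^\gamma |\alpha_n|^2 < \infty .$$ Then there is a set $S \subset \partial\mathbb{D}$ of Hausdorff dimension at most $2(1-\gamma)$ such that for every $z \in \partial\mathbb{D}\setminus S$, $$\sup_{n\ge 0}\|T_n(z)\| < \infty ,$$ where $T_n(z)$ are the Szegő matrices associated with $\mu$. In particular, the singular part $\mu_{\mathrm{sing}}$ of $\mu$ (with respect to Lebesgue measure on $\partial\mathbb{D}$) is supported by a set of Hausdorff dimension at most $2(1-\gamma)$.
   Context: $\mathbb{D}=\{z\in\mathbb{C}:|z|<1\}$ and $\partial\mathbb{D}=\{z\in\mathbb{C}:|z|=1\}$. For a nontrivial probability measure $\mu$ on $\partial\mathbb{D}$, let $\Phi_n(z)$ be the monic orthogonal polynomials in $L^2(\partial\mathbb{D},\mu)$ obtained by applying Gram-Schmidt to $1,z,z^2,\dots$. For a polynomial $P$ of degree $n$ (here $P=\Phi_n,\varphi_n,\psi_n$), the Szegő dual is $P^*(z)=z^n\overline{P(1/\overline{z})}$. The Verblunsky coefficients are the unique numbers $\alpha_n\in\mathbb{D}$, $n \ge 0$, with $\Phi_{n+1}(z)=z\Phi_n(z)-\overline{\alpha}_n\Phi_n^*(z)$; conversely every sequence in $\mathbb{D}$ is the sequence of Verblunsky coefficients of some nontrivial probability measure on $\partial\mathbb{D}$. The orthonormal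 polynomials are $\varphi_n=\Phi_n/\|\Phi_n\|_{L^2(\mu)}$; with $\rho_n=(1-|\alpha_n|^2)^{1/2}$ they satisfy $\varphi_0 = 1$ and $$\begin{bmatrix}\varphi_{n+1}(z)\\ \varphi_{n+1}^*(z)\end{bmatrix}=\frac{1}{\rho_n}\begin{bmatrix} z & -\overline{\alpha}_n\\ -\alpha_n z & 1\end{bmatrix}\begin{bmatrix}\varphi_n(z)\\ \varphi_n^*(z)\end{bmatrix}.$$ The polynomials of the second kind $\psi_n$ are defined by $\psi_0=1$ and $$\begin{bmatrix}\psi_{n+1}(z)\\ -\psi_{n+1}^*(z)\end{bmatrix}=\frac{1}{\rho_n}\begin{bmatrix} z & -\overline{\alpha}_n\\ -\alpha_n z & 1\end{bmatrix}\begin{bmatrix}\psi_n(z)\\ -\psi_n^*(z)\end{bmatrix};$$ equivalently, they are the orthonormal polynomials of the measure with Verblunsky coefficients $-\alpha_n$. The Szegő matrices are $$T_n(z)=\frac12\begin{bmatrix}\varphi_n(z)+\psi_n(z) & \varphi_n(z)-\psi_n(z)\\ \varphi_n^*(z)-\psi_n^*(z) & \varphi_n^*(z)+\psi_n^*(z)\end{bmatrix},\quad n\ge 0,$$ and $\|\cdot\|$ is any fixed matrix norm. A measure is supported by a set if it gives zero mass to the complement of the set. *)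

theory Defs
  imports "HOL-Probability.Probability" "HOL-Computational_Algebra.Polynomial"
begin

section \<open>Measures on the unit circle\<close>

abbreviation unit_circle :: "complex set"
  where "unit_circle \<equiv> sphere 0 1"

text \<open>Requiring \<open>S\<close> to be measurable is essential: \<^const>\<open>emeasure\<close> returns 0 on
  non-measurable sets.\<close>

definition supported_by :: "'a measure \<Rightarrow> 'a set \<Rightarrow> bool"
  where "supported_by M S \<longleftrightarrow> S \<in> sets M \<and> emeasure M (space M - S) = 0"

definition nontrivial_circle_measure :: "complex measure \<Rightarrow> bool"
  where "nontrivial_circle_measure \<mu> \<longleftrightarrow>
    prob_space \<mu> \<and> sets \<mu> = sets (restrict_space borel unit_circle) \<and>
    \<not> (\<exists>F. finite F \<and> supported_by \<mu> F)"

definition circle_lebesgue :: "complex measure"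
  where "circle_lebesgue =
    distr (restrict_space lborel {0..<2 * pi}) (restrict_space borel unit_circle) cis"

definition mutually_singular :: "'a measure \<Rightarrow> 'a measure \<Rightarrow> bool"
  where "mutually_singular M N \<longleftrightarrow>
    (\<exists>A \<in> sets M \<inter> sets N. emeasure M (space M - A) = 0 \<and> emeasure N A = 0)"

text \<open>The singular part of \<open>\<mu>\<close> in its Lebesgue decomposition with respect to \<open>m\<close>; it exists and
  is unique when \<open>m\<close> and \<open>\<mu>\<close> are sigma-finite measures on the same sigma-algebra.\<close>

definition singular_part :: "'a measure \<Rightarrow> 'a measure \<Rightarrow> 'a measure"
  where "singular_part m \<mu> = (THE \<sigma>. sets \<sigma> = sets \<mu> \<and> mutually_singular \<sigma> m \<and>
    (\<exists>\<tau>. sets \<tau> = sets \<mu> \<and> absolutely_continuous m \<tau> \<and>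
      (\<forall>A \<in> sets \<mu>. emeasure \<mu> A = emeasure \<tau> A + emeasure \<sigma> A)))"


section \<open>Hausdorff dimension\<close>

text \<open>The value \<open>diam(U)\<^sup>s\<close>, with the conventions that the empty set contributes 0 and that
  \<open>0\<^sup>0 = 1\<close> (in Isabelle, \<open>0 powr 0 = 0\<close>).\<close>

definition diam_power :: "real \<Rightarrow> 'a::metric_space set \<Rightarrow> ennreal"
  where "diam_power s U =
    (if U = {} then 0 else if s = 0 then 1 else ennreal (diameter U powr s))"

text \<open>Covers are required to consist of bounded sets because \<^const>\<open>diameter\<close> is meaningless
  on unbounded ones.\<close>

definition hausdorff_premeasure :: "real \<Rightarrow> real \<Rightarrow> 'a::metric_space set \<Rightarrow> ennreal"
  where "hausdorff_premeasure s \<delta> S =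
    Inf {(\<Sum>i. diam_power s (U i)) | U :: nat \<Rightarrow> 'a set.
      S \<subseteq> (\<Union>i. U i) \<and> (\<forall>i. bounded (U i) \<and> diameter (U i) \<le> \<delta>)}"

definition hausdorff_measure :: "real \<Rightarrow> 'a::metric_space set \<Rightarrow> ennreal"
  where "hausdorff_measure s S = (SUP \<delta> \<in> {0<..}. hausdorff_premeasure s \<delta> S)"

definition hausdorff_dim :: "'a::metric_space set \<Rightarrow> ennreal"
  where "hausdorff_dim S = Inf {ennreal s | s. 0 \<le> s \<and> hausdorff_measure s S = 0}"


section \<open>Orthogonal polynomials on the unit circle\<close>

definition poly_inner :: "complex measure \<Rightarrow> complex poly \<Rightarrow> complex poly \<Rightarrow> complex"
  where "poly_inner \<mu> P Q = (\<integral>z. cnj (poly P z) * poly Q z \<partial>\<mu>)"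

definition poly_L2_norm :: "complex measure \<Rightarrow> complex poly \<Rightarrow> real"
  where "poly_L2_norm \<mu> P = sqrt (\<integral>z. (cmod (poly P z))\<^sup>2 \<partial>\<mu>)"

text \<open>Gram-Schmidt without normalisation applied to \<open>1, z, z\<^sup>2, \<dots>\<close>.\<close>

fun monic_op :: "complex measure \<Rightarrow> nat \<Rightarrow> complex poly"
  where "monic_op \<mu> n = monom 1 n -
    (\<Sum>k<n. smult (poly_inner \<mu> (monic_op \<mu> k) (monom 1 n) /
                    poly_inner \<mu> (monic_op \<mu> k) (monic_op \<mu> k)) (monic_op \<mu> k))"

declare monic_op.simps [simp del]

definition szego_dual :: "complex poly \<Rightarrow> complex poly"
  where "szego_dual P = reflect_poly (map_poly cnj P)"

lemma poly_szego_dual: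
  assumes "z \<noteq> 0"
  shows "poly (szego_dual P) z = z ^ degree P * cnj (poly P (1 / cnj z))"
proof -
  have "degree (map_poly cnj P) = degree P"
    by (rule degree_map_poly) auto
  moreover have "cnj (poly P (1 / cnj z)) = poly (map_poly cnj P) (inverse z)"
    by (simp only: poly_cnj complex_cnj_divide complex_cnj_one complex_cnj_cnj inverse_eq_divide)
  ultimately show ?thesis
    using assms by (simp add: szego_dual_def poly_reflect_poly_nz)
qed

definition verblunsky :: "complex measure \<Rightarrow> nat \<Rightarrow> complex"
  where "verblunsky \<mu> n = (THE a. cmod a < 1 \<and>
    monic_op \<mu> (Suc n) =
      pCons 0 (monic_op \<mu> n) - smult (cnj a) (szego_dual (monic_op \<mu> n)))"

definition orthonormal_op :: "complex measure \<Rightarrow> nat \<Rightarrow> complex poly"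
  where "orthonormal_op \<mu> n =
    smult (of_real (1 / poly_L2_norm \<mu> (monic_op \<mu> n))) (monic_op \<mu> n)"

text \<open>The first row of the defining matrix recursion of the second kind polynomials. The second
  row is its image under the Szego dual, see \<open>szego_dual_second_kind_Suc\<close> below.\<close>

primrec second_kind :: "(nat \<Rightarrow> complex) \<Rightarrow> nat \<Rightarrow> complex poly"
  where
    "second_kind \<alpha> 0 = 1"
  | "second_kind \<alpha> (Suc n) = smult (of_real (1 / sqrt (1 - (cmod (\<alpha> n))\<^sup>2)))
      (pCons 0 (second_kind \<alpha> n) + smult (cnj (\<alpha> n)) (szego_dual (second_kind \<alpha> n)))"

lemma coeff_szego_dual:
  "coeff (szego_dual P) i = (if i \<le> degree P then cnj (coeff P (degree P - i)) else 0)"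
proof -
  have "degree (map_poly cnj P) = degree P"
    by (rule degree_map_poly) auto
  then show ?thesis
    by (simp add: szego_dual_def coeff_reflect_poly coeff_map_poly)
qed

lemma degree_szego_dual_le: "degree (szego_dual P) \<le> degree P"
  by (rule degree_le) (simp add: coeff_szego_dual)

lemma degree_second_kind:
  assumes "\<And>n. cmod (\<alpha> n) < 1"
  shows "second_kind \<alpha> n \<noteq> 0 \<and> degree (second_kind \<alpha> n) = n"
proof (induction n)
  case (Suc n)
  let ?p = "second_kind \<alpha> n"
  have r: "sqrt (1 - (cmod (\<alpha> n))\<^sup>2) \<noteq> 0"
    using assms[of n] by (simp add: abs_square_eq_1 power2_eq_1_iff)
  have "degree (smult (cnj (\<alpha> n)) (szego_dual ?p)) \<le> n"
    using Suc degree_szego_dual_le[of ?p] by (auto intro: order.trans[OF degree_smult_le])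
  moreover have "degree (pCons 0 ?p) = Suc n"
    using Suc by simp
  ultimately have
    "degree (pCons 0 ?p + smult (cnj (\<alpha> n)) (szego_dual ?p)) = Suc n"
    by (simp add: degree_add_eq_left)
  with r show ?case by auto
qed simp

lemma szego_dual_second_kind_Suc:
  assumes "\<And>n. cmod (\<alpha> n) < 1"
  shows "- szego_dual (second_kind \<alpha> (Suc n)) =
    smult (of_real (1 / sqrt (1 - (cmod (\<alpha> n))\<^sup>2)))
      (smult (- \<alpha> n) (pCons 0 (second_kind \<alpha> n)) + (- szego_dual (second_kind \<alpha> n)))"
proof (rule poly_eqI)
  fix i
  define p where "p = second_kind \<alpha> n"
  define c :: complex where "c = of_real (1 / sqrt (1 - (cmod (\<alpha> n))\<^sup>2))"
  define q where "q = smult c (pCons 0 p + smult (cnj (\<alpha> n)) (szego_dual p))"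
  have q: "second_kind \<alpha> (Suc n) = q"
    by (simp only: second_kind.simps p_def c_def q_def)
  have dp: "degree p = n"
    using degree_second_kind[of \<alpha> n, OF assms] by (simp only: p_def)
  have dq: "degree q = Suc n"
    using degree_second_kind[of \<alpha> "Suc n", OF assms] by (simp only: q)
  have c: "cnj c = c"
    by (simp only: c_def complex_cnj_complex_of_real)
  have "coeff (- szego_dual q) i =
    coeff (smult c (smult (- \<alpha> n) (pCons 0 p) + (- szego_dual p))) i"
  proof (cases i)
    case 0
    then show ?thesis
      by (simp only: coeff_minus coeff_szego_dual dq dp)
         (simp add: q_def c coeff_szego_dual dp)
  next
    case (Suc j)
    have "coeff p j = 0" if "n < j"
      using that by (intro coeff_eq_0) (simp only: dp)
    moreover have "coeff (pCons 0 p) (n - j) = coeff p (n - Suc j)" if "j < n"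
      using that by (simp only: Suc_diff_Suc[symmetric] coeff_pCons_Suc)
    ultimately show ?thesis
      unfolding coeff_minus coeff_szego_dual dq dp Suc
      by (cases "j < n"; cases "j = n")
         (auto simp: q_def c coeff_szego_dual dp algebra_simps)
  qed
  then show "coeff (- szego_dual (second_kind \<alpha> (Suc n))) i =
    coeff (smult (of_real (1 / sqrt (1 - (cmod (\<alpha> n))\<^sup>2)))
      (smult (- \<alpha> n) (pCons 0 (second_kind \<alpha> n)) + (- szego_dual (second_kind \<alpha> n)))) i"
    by (simp only: q p_def[symmetric] c_def[symmetric])
qed

definition szego_matrix :: "complex measure \<Rightarrow> nat \<Rightarrow> complex \<Rightarrow> complex^2^2"
  where "szego_matrix \<mu> n z =
    (let \<phi> = orthonormal_op \<mu> n; \<psi> = second_kind (verblunsky \<mu>) n in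
      vector [vector [(poly \<phi> z + poly \<psi> z) / 2, (poly \<phi> z - poly \<psi> z) / 2],
              vector [(poly (szego_dual \<phi>) z - poly (szego_dual \<psi>) z) / 2,
                      (poly (szego_dual \<phi>) z + poly (szego_dual \<psi>) z) / 2]])"

text \<open>An arbitrary norm on the complex vector space of 2 by 2 matrices; submultiplicativity is
  not required.\<close>

definition is_matrix_norm :: "(complex^2^2 \<Rightarrow> real) \<Rightarrow> bool"
  where "is_matrix_norm N \<longleftrightarrow>
    (\<forall>A. 0 \<le> N A) \<and> (\<forall>A. N A = 0 \<longleftrightarrow> A = 0) \<and>
    (\<forall>c A. N (\<chi> i j. c * A $ i $ j) = cmod c * N A) \<and>
    (\<forall>A B. N (A + B) \<le> N A + N B)"

end

(*
On the circle phi_n(z) is f_n with f_(n+1) = (z f_n - cnj(a_n) z^n cnj(f_n)) / rho_n, and psi_n(z) solves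
the same recursion with -a_n. With the phase u_n = z f_n / (z^n cnj f_n), growth is governed by the partial
sums of a_n u_n, while u_(n+1) = z u_n + O(|a_n|). Split the sum into the blocks 4^k <= n < 4^(k+1). Two
points z, w have phase sequences whose correlation over a block is O((1 + sum |a_n|) / |z - w|), so a large
sieve (duality) inequality bounds by O((k+1)^5 4^(k(1-gamma))) the number of arcs of length 2^-k containing
a point whose block sum exceeds 1/(k+1)^2. Points where f_n is unbounded lie in infinitely many of these
bad arcs, which gives Hausdorff dimension at most 2(1-gamma).

If phi_n(z) and psi_n(z) are bounded by C, variation of constants keeps phi_k(w) close to phi_k(z) for
k <= n and |w - z| <= 1/(4 C^4 n), and testing with the Christoffel-Darboux kernel gives
mu(ball(z, r)) = O(r). Hence mu is absolutely continuous on the set of bounded points, and its singular part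
lives on the same exceptional set.
*)
theory Submission
  imports Defs
begin

text \<open>The dimension comes from a balance of scales. By Cauchy-Schwarz the drift sum |a_n| over
  block k is O(2^k), so points at distance j 2^-k have correlation O(4^k / j). At arc length 2^-k
  the off-diagonal terms thus exceed the trivial diagonal bound 4^k only by a harmonic sum, one
  factor k + 1. The squared coefficients of the block contribute 4^(-k \<gamma>) and the threshold
  costs (k+1)^4; together this is the stated count. For exact rotations, arcs of length 4^-k would
  do; the drift of the phases is the obstacle. The worst partial block sum may end at a different
  index for each arc, so the sieve allows every point its own endpoint, in place of a maximal
  inequality. Both a and -a are needed: phi_n and psi_n have separate phases, and by the constant
  Wronskian a bound on one keeps the other away from 0. That lower bound enters absolute continuity
  twice: it makes the Christoffel-Darboux diagonal at least n / C^2, and it turns the perturbation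
  error into a relative one.\<close>

section \<open>The Szego recursion on the unit circle\<close>

text \<open>On the unit circle \<open>P\<^sup>* (z) = z\<^sup>n cnj (P z)\<close>, so this is the value at \<open>z\<close> of \<open>\<phi>\<^sub>n\<close> when \<open>a\<close> is the
  sequence of Verblunsky coefficients, and of \<open>\<psi>\<^sub>n\<close> when \<open>a\<close> is its negative.\<close>

primrec szego_sol :: "(nat \<Rightarrow> complex) \<Rightarrow> complex \<Rightarrow> nat \<Rightarrow> complex" where
  "szego_sol a z 0 = 1"
| "szego_sol a z (Suc n) = (z * szego_sol a z n - cnj (a n) * z ^ n * cnj (szego_sol a z n)) /
     of_real (sqrt (1 - (cmod (a n))\<^sup>2))"

text \<open>On the circle this is \<open>z\<close> times the quotient of the polynomial by its Szego
  dual; its argument is a Pruefer phase.\<close>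

definition phase :: "(nat \<Rightarrow> complex) \<Rightarrow> complex \<Rightarrow> nat \<Rightarrow> complex" where
  "phase a z n = z * szego_sol a z n / (z ^ n * cnj (szego_sol a z n))"

lemma rho_pos:
  fixes a :: complex
  assumes "cmod a < 1"
  shows "0 < 1 - (cmod a)\<^sup>2" "0 < sqrt (1 - (cmod a)\<^sup>2)"
  using assms by (simp_all add: power_less_one_iff abs_square_less_1)

text \<open>The subtracted term has modulus |a_n| |f_n| < |f_n|, so the numerator of the recursion
  cannot cancel.\<close>

lemma szego_sol_nonzero:
  assumes "\<And>n. cmod (a n) < 1" "cmod z = 1"
  shows "szego_sol a z n \<noteq> 0"
proof (induction n)
  case (Suc n)
  let ?f = "szego_sol a z n"
  have "cmod (cnj (a n) * z ^ n * cnj ?f) < cmod (z * ?f)"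
    using assms Suc by (simp add: norm_mult norm_power)
  then have "z * ?f \<noteq> cnj (a n) * z ^ n * cnj ?f" by auto
  then show ?case
    using rho_pos[OF assms(1)[of n]] by simp
qed simp

lemma norm_phase:
  assumes "\<And>n. cmod (a n) < 1" "cmod z = 1"
  shows "cmod (phase a z n) = 1"
  using szego_sol_nonzero[OF assms] assms(2)
  by (simp add: phase_def norm_mult norm_divide norm_power)

text \<open>The phase u is unimodular, so multiplying z f_n by its conjugate gives z^n cnj(f_n). A
  step therefore sees the phase only through the product a_n u_n.\<close>

lemma szego_sol_Suc_phase:
  assumes "\<And>n. cmod (a n) < 1" "cmod z = 1"
  shows "szego_sol a z (Suc n) = z * szego_sol a z n * (1 - cnj (a n * phase a z n)) /
     of_real (sqrt (1 - (cmod (a n))\<^sup>2))"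
proof -
  let ?f = "szego_sol a z n"
  have f: "?f \<noteq> 0" by (rule szego_sol_nonzero[OF assms])
  have z: "z \<noteq> 0" using assms(2) by auto
  have zz: "z * cnj z = 1" using assms(2) by (simp add: complex_norm_square[symmetric])
  have zn: "z ^ n * cnj z ^ n = 1" by (simp add: power_mult_distrib[symmetric] zz)
  have cz: "cnj z \<noteq> 0" "cnj z ^ n = 1 / z ^ n" using z zn by (auto simp: field_simps)
  have "z * ?f * cnj (phase a z n) = z ^ n * cnj ?f"
    using f z zz cz by (simp add: phase_def field_simps)
  then show ?thesis by (simp add: algebra_simps)
qed

text \<open>The real normalisation cancels against its conjugate. Besides the rotation by z there
  remains the quotient of a number and its conjugate, of modulus 1.\<close>

lemma phase_Suc:
  assumes "\<And>n. cmod (a n) < 1" "cmod z = 1"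
  shows "phase a z (Suc n) =
    z * phase a z n * ((1 - cnj (a n * phase a z n)) / (1 - a n * phase a z n))"
proof -
  let ?f = "szego_sol a z n" and ?u = "phase a z n"
  have f: "?f \<noteq> 0" by (rule szego_sol_nonzero[OF assms])
  have z: "z \<noteq> 0" using assms(2) by auto
  have zz: "cnj z = 1 / z" using assms(2) z by (simp add: complex_norm_square[symmetric] field_simps)
  have "cmod (a n * ?u) < 1" using assms(1) norm_phase[OF assms] by (simp add: norm_mult)
  then have w: "1 - a n * ?u \<noteq> 0" by auto
  have r: "complex_of_real (sqrt (1 - (cmod (a n))\<^sup>2)) \<noteq> 0"
    using rho_pos[OF assms(1)[of n]] by simp
  define r where "r = complex_of_real (sqrt (1 - (cmod (a n))\<^sup>2))"
  have "cnj (szego_sol a z (Suc n)) = cnj ?f * (1 - a n * ?u) / (z * r)"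
    unfolding szego_sol_Suc_phase[OF assms] by (simp add: zz r_def)
  then have "phase a z (Suc n) = z * (z * ?f * (1 - cnj (a n * ?u)) / r) /
      (z ^ Suc n * (cnj ?f * (1 - a n * ?u) / (z * r)))"
    unfolding phase_def[of a z "Suc n"] szego_sol_Suc_phase[OF assms] r_def by simp
  also have "\<dots> = z * (z * ?f / (z ^ n * cnj ?f)) * ((1 - cnj (a n * ?u)) / (1 - a n * ?u))"
    using f z w r by (simp add: r_def[symmetric] divide_simps)
  finally show ?thesis unfolding phase_def[of a z n] .
qed

text \<open>The constant 4 needs no smallness of a_n: if |w| <= 1/2, then |w - cnj w| <= 2|w| and |1
  - w| >= 1/2; otherwise two unimodular numbers differ by at most 2 <= 4|w|.\<close>

lemma phase_Suc_approx:
  assumes "\<And>n. cmod (a n) < 1" "cmod z = 1"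
  shows "cmod (phase a z (Suc n) - z * phase a z n) \<le> 4 * cmod (a n)"
proof -
  define w where "w = a n * phase a z n"
  have nw: "cmod w = cmod (a n)" using norm_phase[OF assms] by (simp add: w_def norm_mult)
  then have w1: "cmod w < 1" using assms(1) by simp
  then have w: "1 - w \<noteq> 0" by auto
  have "phase a z (Suc n) - z * phase a z n = z * phase a z n * ((w - cnj w) / (1 - w))"
    unfolding phase_Suc[OF assms] w_def[symmetric] using w by (simp add: field_simps)
  then have eq: "cmod (phase a z (Suc n) - z * phase a z n) = cmod (w - cnj w) / cmod (1 - w)"
    using norm_phase[OF assms] assms(2) by (simp add: norm_mult norm_divide)
  show ?thesis
  proof (cases "cmod w \<le> 1/2")
    case True
    have "1 - cmod w \<le> cmod (1 - w)" using norm_triangle_ineq2[of 1 w] by simp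
    then have "1/2 \<le> cmod (1 - w)" using True by linarith
    moreover have "cmod (w - cnj w) \<le> 2 * cmod w"
      using norm_triangle_ineq4[of w "cnj w"] by simp
    ultimately have "cmod (w - cnj w) / cmod (1 - w) \<le> (2 * cmod w) / (1/2)"
      by (intro frac_le) auto
    then show ?thesis using eq nw by simp
  next
    case False
    have "cmod (phase a z (Suc n) - z * phase a z n) \<le> 2"
      using norm_triangle_ineq4[of "phase a z (Suc n)" "z * phase a z n"] norm_phase[OF assms] assms(2)
      by (simp add: norm_mult)
    then show ?thesis using False nw by linarith
  qed
qed

text \<open>The squared ratio is |1 - w|^2 / (1 - |a_n|^2) with w = a_n u_n. Using 1 + x <= exp x on
  each factor keeps the linear term exact, because only its oscillation can be controlled; the rest
  is quadratic in a_n.\<close>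

lemma szego_sol_growth:
  assumes "\<And>n. cmod (a n) < 1" "cmod z = 1"
  shows "(cmod (szego_sol a z (Suc n)))\<^sup>2 \<le> (cmod (szego_sol a z n))\<^sup>2 *
    exp (- 2 * Re (a n * phase a z n) + ((cmod (a n))\<^sup>2 + (cmod (a n))\<^sup>2 / (1 - (cmod (a n))\<^sup>2)))"
proof -
  let ?f = "szego_sol a z n"
  define w where "w = a n * phase a z n"
  define A where "A = (cmod (a n))\<^sup>2"
  have A: "0 < 1 - A" using rho_pos[OF assms(1)[of n]] by (simp add: A_def)
  have nw: "(cmod w)\<^sup>2 = A" using norm_phase[OF assms] by (simp add: w_def norm_mult A_def)
  have "(cmod (szego_sol a z (Suc n)))\<^sup>2 = (cmod ?f)\<^sup>2 * (cmod (1 - cnj w))\<^sup>2 / (1 - A)"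
    unfolding szego_sol_Suc_phase[OF assms] w_def[symmetric] A_def[symmetric]
    using assms(2) A by (simp add: norm_mult norm_divide power_mult_distrib power_divide)
  also have "(cmod (1 - cnj w))\<^sup>2 = 1 + (- 2 * Re w + A)"
    unfolding nw[symmetric] cmod_power2 by (simp add: power2_eq_square algebra_simps)
  also have "(cmod ?f)\<^sup>2 * (1 + (- 2 * Re w + A)) / (1 - A)
      = (cmod ?f)\<^sup>2 * ((1 + (- 2 * Re w + A)) * (1 + A / (1 - A)))"
    using A by (simp add: field_simps)
  also have "\<dots> \<le> (cmod ?f)\<^sup>2 * (exp (- 2 * Re w + A) * exp (A / (1 - A)))"
  proof (intro mult_left_mono mult_mono)
    show "1 + (- 2 * Re w + A) \<le> exp (- 2 * Re w + A)" by (rule exp_ge_add_one_self)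
    show "1 + A / (1 - A) \<le> exp (A / (1 - A))" by (rule exp_ge_add_one_self)
    show "0 \<le> 1 + A / (1 - A)" using A by (simp add: A_def)
  qed auto
  also have "exp (- 2 * Re w + A) * exp (A / (1 - A)) = exp (- 2 * Re w + (A + A / (1 - A)))"
    by (simp add: exp_add[symmetric] algebra_simps)
  finally show ?thesis unfolding w_def A_def .
qed

text \<open>The linear terms of the growth estimate add up to the real part of a bounded sum. The
  quadratic ones form a convergent series because |a_n|^2 is eventually below 1/2.\<close>

lemma szego_sol_bounded:
  assumes "\<And>n. cmod (a n) < 1" "cmod z = 1"
    and "summable (\<lambda>n. (cmod (a n))\<^sup>2)"
    and "\<And>m. cmod (\<Sum>n<m. a n * phase a z n) \<le> B"
  shows "\<exists>C. \<forall>n. cmod (szego_sol a z n) \<le> C"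
proof -
  define e where "e n = (cmod (a n))\<^sup>2 + (cmod (a n))\<^sup>2 / (1 - (cmod (a n))\<^sup>2)" for n
  have e0: "0 \<le> e n" for n
    using rho_pos[OF assms(1)[of n]] by (simp add: e_def)
  have "(\<lambda>n. (cmod (a n))\<^sup>2) \<longlonglongrightarrow> 0" using assms(3) by (rule summable_LIMSEQ_zero)
  then have "\<forall>\<^sub>F n in sequentially. (cmod (a n))\<^sup>2 < 1/2"
    by (rule order_tendstoD) simp
  then have ev: "\<forall>\<^sub>F n in sequentially. norm (e n) \<le> 3 * (cmod (a n))\<^sup>2"
  proof (rule eventually_mono)
    fix n assume h: "(cmod (a n))\<^sup>2 < 1/2"
    have "(cmod (a n))\<^sup>2 / (1 - (cmod (a n))\<^sup>2) \<le> (cmod (a n))\<^sup>2 / (1/2)"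
      using h by (intro frac_le) auto
    then show "norm (e n) \<le> 3 * (cmod (a n))\<^sup>2" using e0[of n] by (simp add: e_def)
  qed
  have se: "summable e"
    using summable_comparison_test_ev[OF ev] assms(3) by (simp add: summable_mult)
  have "(cmod (szego_sol a z m))\<^sup>2 \<le> exp (\<Sum>n<m. - 2 * Re (a n * phase a z n) + e n)" for m
  proof (induction m)
    case (Suc m)
    have "(cmod (szego_sol a z (Suc m)))\<^sup>2 \<le> (cmod (szego_sol a z m))\<^sup>2 *
        exp (- 2 * Re (a m * phase a z m) + e m)"
      unfolding e_def by (rule szego_sol_growth[OF assms(1,2)])
    also have "\<dots> \<le> exp (\<Sum>n<m. - 2 * Re (a n * phase a z n) + e n) *
        exp (- 2 * Re (a m * phase a z m) + e m)"
      using Suc by (intro mult_right_mono) auto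
    finally show ?case by (simp add: exp_add[symmetric] del: szego_sol.simps)
  qed simp
  moreover have "(\<Sum>n<m. - 2 * Re (a n * phase a z n) + e n) \<le> 2 * B + suminf e" for m
  proof -
    have "(\<Sum>n<m. e n) \<le> suminf e" by (rule sum_le_suminf[OF se]) (auto simp: e0)
    moreover have "\<bar>Re (\<Sum>n<m. a n * phase a z n)\<bar> \<le> B"
      using abs_Re_le_cmod assms(4) order_trans by blast
    moreover have "(\<Sum>n<m. - 2 * Re (a n * phase a z n) + e n) =
        - 2 * Re (\<Sum>n<m. a n * phase a z n) + (\<Sum>n<m. e n)"
      unfolding sum.distrib Re_sum sum_distrib_left ..
    ultimately show ?thesis by linarith
  qed
  ultimately have b: "(cmod (szego_sol a z m))\<^sup>2 \<le> exp (2 * B + suminf e)" for m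
    by (meson exp_le_cancel_iff order_trans)
  have "cmod (szego_sol a z m) \<le> sqrt (exp (2 * B + suminf e))" for m
    using real_le_rsqrt[OF b] .
  then show ?thesis by blast
qed

text \<open>A partial sum consists of a fixed initial piece, complete blocks and one incomplete
  block. Since \<open>t k\<close> bounds every initial segment of its block, the incomplete one
  costs no more than a complete one.\<close>

lemma partial_sums_bounded_of_blocks:
  fixes c :: "nat \<Rightarrow> complex"
  assumes "\<And>k m. K \<le> k \<Longrightarrow> 4 ^ k \<le> m \<Longrightarrow> m \<le> 4 ^ Suc k \<Longrightarrow> cmod (\<Sum>n\<in>{4 ^ k..<m}. c n) \<le> t k"
    and "summable t"
  shows "\<exists>B. \<forall>m. cmod (\<Sum>n<m. c n) \<le> B"
proof -
  have t0: "0 \<le> t k" if "K \<le> k" for k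
    using assms(1)[OF that, of "4 ^ k"] by simp
  define B where "B = (\<Sum>n<4 ^ K. cmod (c n))"
  have B0: "0 \<le> B" unfolding B_def by (simp add: sum_nonneg)
  have split: "(\<Sum>n<m. c n) = (\<Sum>n<4 ^ k. c n) + (\<Sum>n\<in>{4 ^ k..<m}. c n)" if "4 ^ k \<le> m" for k m
    using that sum.atLeastLessThan_concat[of 0 "4^k" m c] by (simp add: atLeast0LessThan)
  have full: "cmod (\<Sum>n<4 ^ (K + j). c n) \<le> B + (\<Sum>i<j. t (i + K))" for j
  proof (induction j)
    case 0
    show ?case by (simp add: B_def norm_sum)
  next
    case (Suc j)
    have "(4::nat) ^ (K + j) \<le> 4 ^ (K + Suc j)" by (rule power_increasing) auto
    from split[OF this] have "cmod (\<Sum>n<4 ^ (K + Suc j). c n) \<le>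
      cmod (\<Sum>n<4 ^ (K + j). c n) + cmod (\<Sum>n\<in>{4 ^ (K + j)..<4 ^ (K + Suc j)}. c n)"
      by (metis norm_triangle_ineq)
    also have "cmod (\<Sum>n\<in>{4 ^ (K + j)..<4 ^ (K + Suc j)}. c n) \<le> t (K + j)"
      by (rule assms(1)) auto
    finally show ?case using Suc by (simp add: add.commute)
  qed
  have st: "summable (\<lambda>i. t (i + K))" using assms(2) by (simp add: summable_iff_shift)
  have ts: "(\<Sum>i<j. t (i + K)) \<le> (\<Sum>i. t (i + K))" for j
    by (rule sum_le_suminf[OF st]) (auto intro: t0)
  have ts0: "0 \<le> (\<Sum>i. t (i + K))" using ts[of 0] by simp
  have "cmod (\<Sum>n<m. c n) \<le> B + (\<Sum>i. t (i + K))" for m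
  proof (cases "m < 4 ^ K")
    case True
    have "cmod (\<Sum>n<m. c n) \<le> (\<Sum>n<m. cmod (c n))" by (rule norm_sum)
    also have "\<dots> \<le> B" unfolding B_def using True by (intro sum_mono2) auto
    finally show ?thesis using ts0 by linarith
  next
    case False
    define P where "P j \<longleftrightarrow> m < (4::nat) ^ (K + Suc j)" for j
    have "\<exists>j. P j"
    proof
      have "m < (4::nat) ^ m" by (rule less_exp[of m, THEN order_less_le_trans]) (rule power_mono, auto)
      also have "\<dots> \<le> 4 ^ (K + Suc m)" by (rule power_increasing) auto
      finally show "P m" unfolding P_def .
    qed
    \<comment> \<open>Leastness places \<open>m\<close> in the block from 4^(K+j) to 4^(K+j+1); for
      \<open>j = 0\<close> the lower end is the case assumption.\<close>
    define j where "j = (LEAST j. P j)"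
    have j: "m < 4 ^ (K + Suc j)" using LeastI_ex[OF \<open>\<exists>j. P j\<close>] by (simp add: j_def P_def)
    have j2: "4 ^ (K + j) \<le> m"
    proof (cases j)
      case 0 then show ?thesis using False by simp
    next
      case (Suc i)
      then have "\<not> P i" using not_less_Least[of i P] by (simp add: j_def)
      then show ?thesis by (simp add: P_def Suc)
    qed
    have "cmod (\<Sum>n<m. c n) \<le> cmod (\<Sum>n<4 ^ (K + j). c n) + cmod (\<Sum>n\<in>{4 ^ (K + j)..<m}. c n)"
      unfolding split[OF j2] by (rule norm_triangle_ineq)
    also have "\<dots> \<le> (B + (\<Sum>i<j. t (i + K))) + t (j + K)"
      using full[of j] assms(1)[of "K + j" m] j j2 by (simp add: add.commute add_mono)
    also have "\<dots> = B + (\<Sum>i<Suc j. t (i + K))" by simp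
    also have "\<dots> \<le> B + (\<Sum>i. t (i + K))" using ts by (intro add_left_mono)
    finally show ?thesis .
  qed
  then show ?thesis by blast
qed

section \<open>The large sieve\<close>

text \<open>The products x_n = u_n cnj(v_n) nearly follow the rotation by z cnj(w). Multiplying
  their sum by 1 - z cnj(w) thus leaves a telescoping sum, at most 2, and the accumulated errors, at
  most 2 e_n per step.\<close>

lemma near_rotation_correlation:
  fixes u v :: "nat \<Rightarrow> complex" and e :: "nat \<Rightarrow> real"
  assumes u: "\<And>n. cmod (u n) = 1" "\<And>n. cmod (u (Suc n) - z * u n) \<le> e n"
    and v: "\<And>n. cmod (v n) = 1" "\<And>n. cmod (v (Suc n) - w * v n) \<le> e n"
    and z: "cmod z = 1" and w: "cmod w = 1" and "z \<noteq> w"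
  shows "cmod (\<Sum>n\<in>{p..<m}. u n * cnj (v n)) \<le> (2 + 2 * (\<Sum>n\<in>{p..<m}. e n)) / cmod (z - w)"
proof -
  define x where "x n = u n * cnj (v n)" for n
  have x1: "cmod (x n) = 1" for n by (simp add: x_def norm_mult u v)
  have e0: "0 \<le> e n" for n using u(2)[of n] norm_ge_zero order_trans by blast
  have d: "cmod (x (Suc n) - z * cnj w * x n) \<le> 2 * e n" for n
  proof -
    have "x (Suc n) - z * cnj w * x n =
        (u (Suc n) - z * u n) * cnj (v (Suc n)) + z * u n * cnj (v (Suc n) - w * v n)"
      by (simp add: x_def algebra_simps)
    also have "cmod \<dots> \<le> cmod ((u (Suc n) - z * u n) * cnj (v (Suc n))) +
        cmod (z * u n * cnj (v (Suc n) - w * v n))" by (rule norm_triangle_ineq)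
    also have "\<dots> = cmod (u (Suc n) - z * u n) + cmod (v (Suc n) - w * v n)"
      by (simp add: norm_mult u v z w del: complex_cnj_diff)
    finally show ?thesis using u(2)[of n] v(2)[of n] by linarith
  qed
  have tel: "cmod (\<Sum>n\<in>{p..<m}. x n - x (Suc n)) \<le> 2"
  proof (cases "p \<le> m")
    case True
    have "(\<Sum>n\<in>{p..<m}. x n - x (Suc n)) = - (\<Sum>n\<in>{p..<m}. x (Suc n) - x n)"
      by (simp add: sum_negf[symmetric])
    also have "\<dots> = x p - x m" by (simp add: sum_Suc_diff'[OF True])
    finally show ?thesis using norm_triangle_ineq4[of "x p" "x m"] by (simp add: x1)
  qed simp
  have "(1 - z * cnj w) * (\<Sum>n\<in>{p..<m}. x n) =
      (\<Sum>n\<in>{p..<m}. x n - x (Suc n)) + (\<Sum>n\<in>{p..<m}. x (Suc n) - z * cnj w * x n)"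
    unfolding sum.distrib[symmetric] sum_distrib_left by (rule sum.cong) (auto simp: algebra_simps)
  also have "cmod \<dots> \<le> cmod (\<Sum>n\<in>{p..<m}. x n - x (Suc n)) +
      cmod (\<Sum>n\<in>{p..<m}. x (Suc n) - z * cnj w * x n)" by (rule norm_triangle_ineq)
  also have "cmod (\<Sum>n\<in>{p..<m}. x (Suc n) - z * cnj w * x n) \<le> (\<Sum>n\<in>{p..<m}. 2 * e n)"
    by (rule sum_norm_le) (rule d)
  finally have "cmod (1 - z * cnj w) * cmod (\<Sum>n\<in>{p..<m}. x n) \<le> 2 + 2 * (\<Sum>n\<in>{p..<m}. e n)"
    using tel by (simp only: norm_mult sum_distrib_left[symmetric]) linarith
  moreover have "cmod (1 - z * cnj w) = cmod (z - w)"
  proof -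
    have "1 - z * cnj w = (w - z) * cnj w"
      using w by (simp add: algebra_simps complex_norm_square[symmetric])
    then show ?thesis by (simp add: norm_mult w norm_minus_commute)
  qed
  ultimately show ?thesis
    using \<open>z \<noteq> w\<close> by (simp add: x_def pos_le_divide_eq mult.commute)
qed

text \<open>Unimodular weights make all sums nonnegative; after exchanging the order of summation,
  Cauchy-Schwarz in n separates \<open>a\<close> from the weighted combination of the
  \<open>x i\<close>, whose square expands into correlations. Extending each \<open>x i\<close> by 0
  beyond \<open>m i\<close> handles the different endpoints and produces the
  \<open>min\<close>.\<close>

lemma large_sieve_duality:
  fixes x :: "'i \<Rightarrow> nat \<Rightarrow> complex" and a :: "nat \<Rightarrow> complex"
  assumes "finite I" "\<And>i. i \<in> I \<Longrightarrow> m i \<le> q"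
  shows "(\<Sum>i\<in>I. cmod (\<Sum>n\<in>{p..<m i}. a n * x i n))\<^sup>2 \<le> (\<Sum>n\<in>{p..<q}. (cmod (a n))\<^sup>2) *
    (\<Sum>i\<in>I. \<Sum>j\<in>I. cmod (\<Sum>n\<in>{p..<min (m i) (m j)}. x i n * cnj (x j n)))"
proof -
  define s where "s i = (\<Sum>n\<in>{p..<m i}. a n * x i n)" for i
  define c where "c i = cnj (sgn (s i))" for i
  define y where "y i n = (if n < m i then x i n else 0)" for i n
  define Y where "Y n = (\<Sum>i\<in>I. c i * y i n)" for n
  \<comment> \<open>Only an inequality, since \<open>sgn 0 = 0\<close> makes the weight vanish when
    the sum does.\<close>
  have c1: "cmod (c i) \<le> 1" for i by (simp add: c_def norm_sgn)
  have cs: "c i * s i = of_real (cmod (s i))" for i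
    by (cases "s i = 0") (simp_all add: c_def sgn_div_norm scaleR_conv_of_real field_simps
        complex_norm_square[symmetric] power2_eq_square mult.commute)
  have sy: "s i = (\<Sum>n\<in>{p..<q}. a n * y i n)" if "i \<in> I" for i
    unfolding s_def y_def using assms(2)[OF that]
    by (intro sum.mono_neutral_cong_left) auto
  have "of_real (\<Sum>i\<in>I. cmod (s i)) = (\<Sum>i\<in>I. c i * s i)" by (simp add: cs)
  also have "\<dots> = (\<Sum>i\<in>I. \<Sum>n\<in>{p..<q}. a n * (c i * y i n))"
    by (rule sum.cong) (auto simp: sy sum_distrib_left mult_ac)
  also have "\<dots> = (\<Sum>n\<in>{p..<q}. a n * Y n)"
    unfolding Y_def sum_distrib_left by (rule sum.swap)
  finally have e: "complex_of_real (\<Sum>i\<in>I. cmod (s i)) = (\<Sum>n\<in>{p..<q}. a n * Y n)" .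
  have "cmod (complex_of_real (\<Sum>i\<in>I. cmod (s i))) = (\<Sum>i\<in>I. cmod (s i))"
    unfolding norm_of_real by (rule abs_of_nonneg) (simp add: sum_nonneg)
  then have "(\<Sum>i\<in>I. cmod (s i)) \<le> (\<Sum>n\<in>{p..<q}. cmod (a n) * cmod (Y n))"
    using e norm_sum[of "\<lambda>n. a n * Y n" "{p..<q}"] by (simp add: norm_mult)
  then have "(\<Sum>i\<in>I. cmod (s i))\<^sup>2 \<le> (\<Sum>n\<in>{p..<q}. cmod (a n) * cmod (Y n))\<^sup>2"
    by (intro power_mono) (auto intro: sum_nonneg)
  also have "\<dots> \<le> (\<Sum>n\<in>{p..<q}. (cmod (a n))\<^sup>2) * (\<Sum>n\<in>{p..<q}. (cmod (Y n))\<^sup>2)"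
    by (rule Cauchy_Schwarz_ineq_sum)
  also have "\<dots> \<le> (\<Sum>n\<in>{p..<q}. (cmod (a n))\<^sup>2) *
    (\<Sum>i\<in>I. \<Sum>j\<in>I. cmod (\<Sum>n\<in>{p..<min (m i) (m j)}. x i n * cnj (x j n)))"
  proof (intro mult_left_mono)
    have inner: "(\<Sum>n\<in>{p..<q}. y i n * cnj (y j n)) =
        (\<Sum>n\<in>{p..<min (m i) (m j)}. x i n * cnj (x j n))" if "i \<in> I" "j \<in> I" for i j
      unfolding y_def using assms(2)[OF that(1)]
      by (intro sum.mono_neutral_cong_right) (auto split: if_splits)
    have "complex_of_real (\<Sum>n\<in>{p..<q}. (cmod (Y n))\<^sup>2) = (\<Sum>n\<in>{p..<q}. Y n * cnj (Y n))"
      by (simp only: of_real_sum complex_norm_square)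
    also have "\<dots> = (\<Sum>n\<in>{p..<q}. \<Sum>i\<in>I. \<Sum>j\<in>I. c i * cnj (c j) * (y i n * cnj (y j n)))"
      unfolding Y_def cnj_sum sum_product by (simp add: mult_ac)
    also have "\<dots> = (\<Sum>i\<in>I. \<Sum>n\<in>{p..<q}. \<Sum>j\<in>I. c i * cnj (c j) * (y i n * cnj (y j n)))"
      by (rule sum.swap)
    also have "\<dots> = (\<Sum>i\<in>I. \<Sum>j\<in>I. \<Sum>n\<in>{p..<q}. c i * cnj (c j) * (y i n * cnj (y j n)))"
      by (rule sum.cong[OF refl], rule sum.swap)
    also have "\<dots> = (\<Sum>i\<in>I. \<Sum>j\<in>I. c i * cnj (c j) *
        (\<Sum>n\<in>{p..<min (m i) (m j)}. x i n * cnj (x j n)))"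
      by (intro sum.cong refl) (simp add: sum_distrib_left[symmetric] inner)
    finally have "cmod (complex_of_real (\<Sum>n\<in>{p..<q}. (cmod (Y n))\<^sup>2)) = cmod (\<Sum>i\<in>I. \<Sum>j\<in>I.
        c i * cnj (c j) * (\<Sum>n\<in>{p..<min (m i) (m j)}. x i n * cnj (x j n)))" by simp
    also have "\<dots> \<le> (\<Sum>i\<in>I. \<Sum>j\<in>I. cmod (\<Sum>n\<in>{p..<min (m i) (m j)}. x i n * cnj (x j n)))"
    proof (intro sum_norm_le)
      fix i j
      have "cmod (c i) * cmod (c j) \<le> 1 * 1" by (intro mult_mono c1) auto
      then show "cmod (c i * cnj (c j) * (\<Sum>n\<in>{p..<min (m i) (m j)}. x i n * cnj (x j n)))
          \<le> cmod (\<Sum>n\<in>{p..<min (m i) (m j)}. x i n * cnj (x j n))"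
        by (simp add: norm_mult mult_left_le_one_le)
    qed
    finally show "(\<Sum>n\<in>{p..<q}. (cmod (Y n))\<^sup>2) \<le>
        (\<Sum>i\<in>I. \<Sum>j\<in>I. cmod (\<Sum>n\<in>{p..<min (m i) (m j)}. x i n * cnj (x j n)))"
      using norm_ge_zero by (simp only: norm_of_real abs_of_nonneg sum_nonneg zero_le_power2)
  qed (simp add: sum_nonneg)
  finally show ?thesis unfolding s_def .
qed

text \<open>In each row of the correlation matrix at most three entries (the index and its two
  neighbours) get the trivial bound \<open>q - p\<close>; at every larger distance there are at most
  two entries, whence \<open>2 * B\<close> times a harmonic sum.\<close>

lemma large_sieve_count:
  fixes x :: "int \<Rightarrow> nat \<Rightarrow> complex" and a :: "nat \<Rightarrow> complex" and I :: "int set"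
  assumes I: "I \<subseteq> {- int M..int M}" and m: "\<And>i. i \<in> I \<Longrightarrow> m i \<le> q"
    and t: "0 \<le> t" "\<And>i. i \<in> I \<Longrightarrow> t \<le> cmod (\<Sum>n\<in>{p..<m i}. a n * x i n)"
    and x: "\<And>i n. i \<in> I \<Longrightarrow> cmod (x i n) = 1"
    and B: "0 \<le> B" "\<And>i j r. i \<in> I \<Longrightarrow> j \<in> I \<Longrightarrow> r \<le> q \<Longrightarrow> 2 \<le> \<bar>i - j\<bar> \<Longrightarrow>
      cmod (\<Sum>n\<in>{p..<r}. x i n * cnj (x j n)) \<le> B / (real_of_int \<bar>i - j\<bar> - 1)"
  shows "real (card I) * t\<^sup>2 \<le> (\<Sum>n\<in>{p..<q}. (cmod (a n))\<^sup>2) *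
    (3 * real (q - p) + 2 * B * (\<Sum>d=1..2 * M. 1 / real d))"
proof -
  have fin: "finite I" using I finite_subset by blast
  define L where "L = real (q - p)"
  define H where "H = (\<Sum>d=1..2 * M. 1 / real d)"
  define D where "D i j = cmod (\<Sum>n\<in>{p..<min (m i) (m j)}. x i n * cnj (x j n))" for i j
  have row: "(\<Sum>j\<in>I. D i j) \<le> 3 * L + 2 * B * H" if i: "i \<in> I" for i
  proof -
    have near: "D i j \<le> L" if j: "j \<in> I" for j
    proof -
      have "D i j \<le> (\<Sum>n\<in>{p..<min (m i) (m j)}. 1)"
        unfolding D_def by (rule sum_norm_le) (simp add: norm_mult x i j)
      also have "\<dots> \<le> L" unfolding L_def using m[OF i] m[OF j] by auto
      finally show ?thesis .
    qed
    have far: "D i j \<le> B * (1 / (real_of_int \<bar>i - j\<bar> - 1))" if "j \<in> I" "2 \<le> \<bar>i - j\<bar>" for j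
      using B(2)[OF i that(1) _ that(2), of "min (m i) (m j)"] m[OF i] unfolding D_def by auto
    have "(\<Sum>j\<in>I. D i j) = (\<Sum>j\<in>I \<inter> {i-1..i+1}. D i j) + (\<Sum>j\<in>I - {i-1..i+1}. D i j)"
      using fin by (metis sum.Int_Diff)
    also have "(\<Sum>j\<in>I \<inter> {i-1..i+1}. D i j) \<le> of_nat (card (I \<inter> {i-1..i+1})) * L"
      by (rule sum_bounded_above) (use near in auto)
    also have "\<dots> \<le> 3 * L"
    proof (intro mult_right_mono)
      have "card (I \<inter> {i-1..i+1}) \<le> card {i-1..i+1}" by (rule card_mono) auto
      then show "real (card (I \<inter> {i-1..i+1})) \<le> 3" by simp
    qed (simp add: L_def)
    also have "(\<Sum>j\<in>I - {i-1..i+1}. D i j) \<le>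
        (\<Sum>j\<in>I - {i-1..i+1}. B * (1 / (real_of_int \<bar>i - j\<bar> - 1)))"
      by (rule sum_mono, rule far) auto
    also have "\<dots> = B * (\<Sum>j\<in>I - {i-1..i+1}. 1 / (real_of_int \<bar>i - j\<bar> - 1))"
      by (simp add: sum_distrib_left)
    also have "\<dots> \<le> B * (2 * H)"
    proof (rule mult_left_mono[OF _ B(1)])
      have "(\<Sum>j\<in>I - {i-1..i+1}. 1 / (real_of_int \<bar>i - j\<bar> - 1)) \<le>
          (\<Sum>(d, e)\<in>{1..2 * M} \<times> {-1, 1 :: int}. 1 / real d)"
      \<comment> \<open>A far index is coded by its distance \<open>d + 1\<close> from
        \<open>i\<close> and its side \<open>e\<close>; both indices lie in [-M, M], hence d <=
        2M.\<close>
      proof (rule sum_le_included[where i = "\<lambda>(d::nat, e::int). i + e * (int d + 1)"])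
        show "\<forall>j\<in>I - {i-1..i+1}. \<exists>y\<in>{1..2 * M} \<times> {-1, 1}.
            (case y of (d, e) \<Rightarrow> i + e * (int d + 1)) = j \<and>
            1 / (real_of_int \<bar>i - j\<bar> - 1) \<le> (case y of (d, e) \<Rightarrow> 1 / real d)"
        proof
          fix j assume j: "j \<in> I - {i-1..i+1}"
          have "i \<in> {- int M..int M}" "j \<in> {- int M..int M}" using i j I by auto
          then have h: "\<bar>i - j\<bar> \<ge> 2" "\<bar>i\<bar> \<le> int M" "\<bar>j\<bar> \<le> int M" using j by auto
          define d where "d = nat (\<bar>i - j\<bar> - 1)"
          have d: "int d = \<bar>i - j\<bar> - 1" "d \<in> {1..2 * M}" using h by (auto simp: d_def)
          have "real d = real_of_int \<bar>i - j\<bar> - 1" using d(1)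
            by (metis of_int_1 of_int_diff of_int_of_nat_eq)
          then show "\<exists>y\<in>{1..2 * M} \<times> {-1, 1}.
            (case y of (d, e) \<Rightarrow> i + e * (int d + 1)) = j \<and>
            1 / (real_of_int \<bar>i - j\<bar> - 1) \<le> (case y of (d, e) \<Rightarrow> 1 / real d)"
            using d h by (intro bexI[of _ "(d, sgn (j - i))"]) (auto simp: sgn_if)
        qed
      qed (use fin in auto)
      also have "\<dots> = 2 * H"
        unfolding H_def by (simp add: sum.cartesian_product[symmetric] sum_distrib_left)
      finally show "(\<Sum>j\<in>I - {i-1..i+1}. 1 / (real_of_int \<bar>i - j\<bar> - 1)) \<le> 2 * H" .
    qed
    finally show ?thesis by (simp add: algebra_simps)
  qed
  define A where "A = (\<Sum>n\<in>{p..<q}. (cmod (a n))\<^sup>2)"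
  have A0: "0 \<le> A" unfolding A_def by (simp add: sum_nonneg)
  have "real (card I) * t \<le> (\<Sum>i\<in>I. cmod (\<Sum>n\<in>{p..<m i}. a n * x i n))"
    by (rule sum_bounded_below) (rule t(2))
  then have "(real (card I) * t)\<^sup>2 \<le> (\<Sum>i\<in>I. cmod (\<Sum>n\<in>{p..<m i}. a n * x i n))\<^sup>2"
    using t(1) by (intro power_mono) auto
  also have "\<dots> \<le> A * (\<Sum>i\<in>I. \<Sum>j\<in>I. D i j)"
    unfolding A_def D_def by (rule large_sieve_duality[OF fin m])
  also have "\<dots> \<le> A * (real (card I) * (3 * L + 2 * B * H))"
    by (rule mult_left_mono[OF sum_bounded_above[OF row] A0])
  \<comment> \<open>The left side is quadratic in the number of points and the right side linear, so
    one factor cancels.\<close>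
  finally have "real (card I) * (real (card I) * t\<^sup>2) \<le> real (card I) * (A * (3 * L + 2 * B * H))"
    by (simp add: power2_eq_square mult_ac)
  moreover have "0 \<le> A * (3 * L + 2 * B * H)"
    using A0 B(1) by (simp add: L_def H_def sum_nonneg)
  ultimately have "real (card I) * t\<^sup>2 \<le> A * (3 * L + 2 * B * H)"
    by (cases "card I = 0") (auto dest: mult_left_le_imp_le)
  then show ?thesis unfolding A_def L_def H_def .
qed

text \<open>Doubling the range adds 2^n terms, each at most 2^-n.\<close>

lemma harmonic_sum_pow2_le: "(\<Sum>d=1..2 ^ n. 1 / real d) \<le> real n + 1"
proof (induction n)
  case (Suc n)
  have "{1..2 ^ Suc n} = {1..2 ^ n} \<union> {2 ^ n + 1..2 ^ Suc n :: nat}" by auto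
  then have "(\<Sum>d=1..2 ^ Suc n. 1 / real d) =
      (\<Sum>d=1..2 ^ n. 1 / real d) + (\<Sum>d=2 ^ n + 1..2 ^ Suc n. 1 / real d)"
    by (simp only:) (rule sum.union_disjoint, auto)
  also have "(\<Sum>d=2 ^ n + 1..2 ^ Suc n. 1 / real d) \<le> real (card {2 ^ n + 1..2 ^ Suc n :: nat}) * (1 / 2 ^ n)"
  proof (rule sum_bounded_above)
    fix d assume d: "d \<in> {2 ^ n + 1..2 ^ Suc n :: nat}"
    then have "2 ^ n \<le> real d" using of_nat_le_iff[where 'a=real, of "2 ^ n" d] by auto
    moreover from this have "0 < real d" using zero_less_power[of "2::real" n] by linarith
    ultimately show "1 / real d \<le> 1 / 2 ^ n" by (intro divide_left_mono) auto
  qed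
  also have "\<dots> = 1" by simp
  finally show ?case using Suc by simp
qed simp

section \<open>Covering the unbounded set\<close>

text \<open>This is the convergence half of Borel-Cantelli for Hausdorff measure: for every K the
  families \<open>F k\<close> with k >= K cover \<open>S\<close>, and their total cost is a tail of
  a convergent series.\<close>

lemma hausdorff_measure_limsup_zero:
  fixes F :: "nat \<Rightarrow> 'a::metric_space set set"
  assumes s: "0 < s"
    and F: "\<And>k. finite (F k)" "\<And>k U. U \<in> F k \<Longrightarrow> bounded U" "\<And>k U. U \<in> F k \<Longrightarrow> diameter U \<le> d k"
    and d: "d \<longlonglongrightarrow> 0"
    and sm: "summable (\<lambda>k. real (card (F k)) * d k powr s)"
    and S: "\<And>x. x \<in> S \<Longrightarrow> \<exists>\<^sub>\<infinity>k. x \<in> \<Union>(F k)"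
  shows "hausdorff_measure s S = 0"
proof -
  have "hausdorff_premeasure s \<delta> S = 0" if \<delta>: "0 < \<delta>" for \<delta>
  proof -
    have "hausdorff_premeasure s \<delta> S \<le> 0 + ennreal e" if e: "0 < e" for e
    proof -
      obtain K1 where K1: "\<And>k. K1 \<le> k \<Longrightarrow> d k < \<delta>"
        using order_tendstoD(2)[OF d \<delta>] by (auto simp: eventually_sequentially)
      define c where "c k = real (card (F k)) * d k powr s" for k
      have c0: "0 \<le> c k" for k by (simp add: c_def)
      have sc: "summable c" using sm by (simp add: c_def[abs_def])
      obtain K2 where K2: "\<And>n. K2 \<le> n \<Longrightarrow> norm (\<Sum>i. c (i + n)) < e"
        using suminf_exist_split[OF e sc] by blast
      define K where "K = max K1 K2"
      have "\<forall>k. \<exists>E. bij_betw E {0..<card (F k)} (F k)"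
        using ex_bij_betw_nat_finite[OF F(1)] by blast
      then obtain E where E: "\<And>k. bij_betw (E k) {0..<card (F k)} (F k)" by metis
      have EF: "E k j \<in> F k" if "j < card (F k)" for k j
        using bij_betwE[OF E[of k]] that by auto
      \<comment> \<open>Each finite family is padded with empty sets, which cost 0, so that the
        double family can be listed as the single sequence that the premeasure demands.\<close>
      define V where "V = (\<lambda>(k, j). if j < card (F (k + K)) then E (k + K) j else {})"
      define U where "U n = V (prod_decode n)" for n
      have sub: "S \<subseteq> (\<Union>n. U n)"
      proof
        fix x assume "x \<in> S"
        from S[OF this] obtain k where k: "K \<le> k" "x \<in> \<Union>(F k)"
          unfolding INFM_nat_le by blast
        then obtain W where "W \<in> F k" "x \<in> W" by auto
        then have "W \<in> E k ` {0..<card (F k)}" by (simp only: bij_betw_imp_surj_on[OF E])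
        then obtain j where j: "j < card (F k)" "x \<in> E k j" using \<open>x \<in> W\<close> by auto
        have "x \<in> U (prod_encode (k - K, j))" using k j by (simp add: U_def V_def)
        then show "x \<in> (\<Union>n. U n)" by blast
      qed
      have bd: "bounded (V p) \<and> diameter (V p) \<le> \<delta>" for p
      proof (cases p)
        case (Pair k j)
        then show ?thesis
        proof (cases "j < card (F (k + K))")
          case True
          have "d (k + K) < \<delta>" using K1[of "k + K"] by (simp add: K_def)
          then show ?thesis using F(2,3)[OF EF[OF True]] True Pair by (simp add: V_def)
        qed (use \<delta> Pair in \<open>simp add: V_def\<close>)
      qed
      have dp: "diam_power s (V (k, j)) \<le> (if j < card (F (k + K)) then ennreal (d (k + K) powr s) else 0)" for k j
      proof (cases "j < card (F (k + K))")
        case True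
        have "diameter (E (k + K) j) powr s \<le> d (k + K) powr s"
          using F(2,3)[OF EF[OF True]] s by (intro powr_mono2 diameter_ge_0) auto
        then show ?thesis using True s by (simp add: V_def diam_power_def ennreal_leI)
      qed (simp add: V_def diam_power_def)
      have row: "(\<Sum>j. diam_power s (V (k, j))) \<le> ennreal (c (k + K))" for k
      proof -
        have "(\<Sum>j. diam_power s (V (k, j))) \<le>
            (\<Sum>j. if j < card (F (k + K)) then ennreal (d (k + K) powr s) else 0)"
          by (rule suminf_le) (use dp in auto)
        also have "\<dots> = (\<Sum>j<card (F (k + K)). ennreal (d (k + K) powr s))"
          by (subst suminf_finite[of "{..<card (F (k + K))}"]) auto
        also have "\<dots> = ennreal (c (k + K))"
          by (simp add: c_def ennreal_mult ennreal_of_nat_eq_real_of_nat)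
        finally show ?thesis .
      qed
      have "(\<Sum>n. diam_power s (U n)) = (\<Sum>k. \<Sum>j. diam_power s (V (k, j)))"
        unfolding U_def by (rule suminf_ennreal_2dimen[where f = "\<lambda>p. diam_power s (V p)"]) (rule refl)
      also have "\<dots> \<le> (\<Sum>k. ennreal (c (k + K)))"
        by (rule suminf_le) (use row in auto)
      also have "\<dots> = ennreal (\<Sum>k. c (k + K))"
        using sc c0 by (intro suminf_ennreal2) (auto simp: summable_iff_shift)
      also have "\<dots> \<le> ennreal e"
        using K2[of K] by (intro ennreal_leI) (simp add: K_def)
      finally have tot: "(\<Sum>n. diam_power s (U n)) \<le> ennreal e" .
      show ?thesis
        unfolding hausdorff_premeasure_def
      proof (rule Inf_lower2)
        show "(\<Sum>n. diam_power s (U n)) \<in> {(\<Sum>i. diam_power s (U i)) |U.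
            S \<subseteq> (\<Union>i. U i) \<and> (\<forall>i. bounded (U i) \<and> diameter (U i) \<le> \<delta>)}"
          using sub bd by (intro CollectI exI[of _ U]) (simp add: U_def)
      qed (use tot in simp)
    qed
    then have "hausdorff_premeasure s \<delta> S \<le> 0" by (rule ennreal_le_epsilon)
    then show ?thesis by simp
  qed
  then have "hausdorff_measure s S \<le> 0"
    unfolding hausdorff_measure_def by (intro SUP_least) simp
  then show ?thesis by simp
qed

text \<open>The thresholds \<open>1 / (k + 1)\<^sup>2\<close> are summable, so the partial sums of \<open>a\<^sub>n u\<^sub>n\<close> stay bounded at a point
  that lies in finitely many bad blocks only.\<close>

definition bad_block :: "(nat \<Rightarrow> complex) \<Rightarrow> nat \<Rightarrow> complex set" where
  "bad_block a k = {z. cmod z = 1 \<and> (\<exists>m. 4 ^ k \<le> m \<and> m \<le> 4 ^ Suc k \<and>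
     1 / (real k + 1)\<^sup>2 < cmod (\<Sum>n\<in>{4 ^ k..<m}. a n * phase a z n))}"

text \<open>For \<open>q = 0, 1, 2, 3\<close>, the arc \<open>Re (\<i>\<^sup>q z) \<ge> 1/2\<close> is a graph over \<open>Im (\<i>\<^sup>q z)\<close>, with bounded slope.\<close>

definition cell :: "nat \<Rightarrow> nat \<Rightarrow> int \<Rightarrow> complex set" where
  "cell k q i = {z. cmod z = 1 \<and> 1/2 \<le> Re (\<i> ^ q * z) \<and> \<lfloor>2 ^ k * Im (\<i> ^ q * z)\<rfloor> = i}"

lemma norm_i_power_mult [simp]: "cmod (\<i> ^ q * z) = cmod z"
  by (simp add: norm_mult norm_power)

lemma cell_index_range:
  assumes "z \<in> cell k q i"
  shows "i \<in> {- (2 ^ k)..2 ^ k}"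
proof -
  define y where "y = Im (\<i> ^ q * z)"
  have "\<bar>y\<bar> \<le> 1" using abs_Im_le_cmod[of "\<i> ^ q * z"] assms by (simp add: cell_def y_def)
  then have "\<bar>2 ^ k * y\<bar> \<le> 2 ^ k" by (simp add: abs_mult)
  then have "2 ^ k * y \<le> 2 ^ k" "- (2 ^ k) \<le> 2 ^ k * y" by linarith+
  then have h: "2 ^ k * y \<le> real_of_int (2 ^ k)" "real_of_int (- (2 ^ k)) \<le> 2 ^ k * y"
    by (simp_all only: of_int_power of_int_minus of_int_numeral)
  have "- (2 ^ k) \<le> \<lfloor>2 ^ k * y\<rfloor>" using h(2) by (simp only: le_floor_iff)
  moreover have "\<lfloor>2 ^ k * y\<rfloor> \<le> 2 ^ k" using floor_mono[OF h(1)] by (simp only: floor_of_int)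
  ultimately show ?thesis using assms by (simp add: cell_def y_def)
qed

text \<open>The rotated imaginary part is 1-Lipschitz and taking floors loses less than 1.
  Neighbouring cells may touch, so nothing better than \<open>- 1\<close> holds.\<close>

lemma cell_separation:
  assumes "z \<in> cell k q i" "w \<in> cell k q j"
  shows "real_of_int \<bar>i - j\<bar> - 1 \<le> 2 ^ k * cmod (z - w)"
proof -
  define x y where "x = 2 ^ k * Im (\<i> ^ q * z)" and "y = 2 ^ k * Im (\<i> ^ q * w)"
  have "x - y = 2 ^ k * Im (\<i> ^ q * (z - w))"
    unfolding x_def y_def by (simp only: right_diff_distrib minus_complex.sel)
  then have "\<bar>x - y\<bar> = 2 ^ k * \<bar>Im (\<i> ^ q * (z - w))\<bar>" by (simp only: abs_mult) simp
  also have "\<dots> \<le> 2 ^ k * cmod (z - w)"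
    using abs_Im_le_cmod[of "\<i> ^ q * (z - w)"] by (intro mult_left_mono) (simp_all only: norm_i_power_mult, auto)
  finally have "\<bar>x - y\<bar> \<le> 2 ^ k * cmod (z - w)" .
  moreover have "i = \<lfloor>x\<rfloor>" "j = \<lfloor>y\<rfloor>" using assms by (auto simp: cell_def x_def y_def)
  ultimately show ?thesis by linarith
qed

text \<open>The 3 is 1 from the imaginary parts plus 2 from the real parts: subtracting the circle
  equations gives (Re Z - Re W)(Re Z + Re W) = -(Im Z - Im W)(Im Z + Im W), with Re Z + Re W >= 1
  and |Im Z + Im W| <= 2.\<close>

lemma cell_dist:
  assumes "z \<in> cell k q i" "w \<in> cell k q i"
  shows "cmod (z - w) \<le> 3 / 2 ^ k"
proof -
  define Z W where "Z = \<i> ^ q * z" and "W = \<i> ^ q * w"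
  have "\<lfloor>2 ^ k * Im Z\<rfloor> = \<lfloor>2 ^ k * Im W\<rfloor>" using assms by (simp add: cell_def Z_def W_def)
  then have "\<bar>2 ^ k * Im Z - 2 ^ k * Im W\<bar> \<le> 1" by linarith
  then have "2 ^ k * \<bar>Im Z - Im W\<bar> \<le> 1"
    by (simp only: abs_mult flip: right_diff_distrib) simp
  then have im: "\<bar>Im Z - Im W\<bar> \<le> 1 / 2 ^ k" by (simp add: pos_le_divide_eq mult.commute)
  have re: "1/2 \<le> Re Z" "1/2 \<le> Re W" "cmod Z = 1" "cmod W = 1"
    using assms by (auto simp: cell_def Z_def W_def)
  then have "(Re Z)\<^sup>2 + (Im Z)\<^sup>2 = 1" "(Re W)\<^sup>2 + (Im W)\<^sup>2 = 1"
    by (metis cmod_power2 one_power2)+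
  then have eq: "(Re Z - Re W) * (Re Z + Re W) = - ((Im Z - Im W) * (Im Z + Im W))"
    by (simp add: algebra_simps power2_eq_square)
  have "\<bar>Re Z - Re W\<bar> * 1 \<le> \<bar>Re Z - Re W\<bar> * (Re Z + Re W)"
    using re by (intro mult_left_mono) auto
  also have "\<dots> = \<bar>(Re Z - Re W) * (Re Z + Re W)\<bar>" using re by (simp add: abs_mult)
  also have "\<dots> = \<bar>Im Z - Im W\<bar> * \<bar>Im Z + Im W\<bar>" unfolding eq by (simp add: abs_mult)
  also have "\<dots> \<le> (1 / 2 ^ k) * 2"
    using im abs_Im_le_cmod[of Z] abs_Im_le_cmod[of W] re by (intro mult_mono) auto
  finally have "\<bar>Re (Z - W)\<bar> + \<bar>Im (Z - W)\<bar> \<le> 3 / 2 ^ k" using im by simp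
  moreover have "cmod (z - w) = cmod (Z - W)"
    unfolding Z_def W_def by (simp only: norm_i_power_mult flip: right_diff_distrib)
  ultimately show ?thesis using cmod_le[of "Z - W"] by linarith
qed

text \<open>The two coordinates cannot both be below 1/2 in modulus, since their squares add up to
  1; a power of \<i> turns the large one into a positive real part.\<close>

lemma ex_cell:
  assumes "cmod z = 1"
  shows "\<exists>q<4. \<exists>i. z \<in> cell k q i"
proof -
  have sq: "(Re z)\<^sup>2 + (Im z)\<^sup>2 = 1" using assms by (metis cmod_power2 one_power2)
  have "1/2 \<le> \<bar>Re z\<bar> \<or> 1/2 \<le> \<bar>Im z\<bar>"
  proof (rule ccontr)
    assume "\<not> ?thesis"
    then have "\<bar>Re z\<bar> ^ 2 \<le> (1/2) ^ 2" "\<bar>Im z\<bar> ^ 2 \<le> (1/2) ^ 2" by (intro power_mono; simp)+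
    then show False using sq by (simp add: power2_eq_square)
  qed
  then consider "1/2 \<le> Re z" | "1/2 \<le> - Re z" | "1/2 \<le> Im z" | "1/2 \<le> - Im z"
    by linarith
  then have "\<exists>q<4. 1/2 \<le> Re (\<i> ^ q * z)"
  proof cases
    case 1 then show ?thesis by (intro exI[of _ 0]) auto
  next
    case 2 then show ?thesis by (intro exI[of _ 2]) auto
  next
    case 3 then show ?thesis by (intro exI[of _ 3]) (auto simp: power3_eq_cube)
  next
    case 4 then show ?thesis by (intro exI[of _ 1]) auto
  qed
  then show ?thesis using assms by (auto simp: cell_def)
qed

text \<open>Choose one bad point in each bad cell. These points are \<open>2\<^sup>-\<^sup>k\<close>-separated up to neighbours, which makes
  their phase sequences almost orthogonal on the block.\<close>

lemma card_bad_cells: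
  fixes a :: "nat \<Rightarrow> complex" and k q :: nat
  assumes a: "\<And>n. cmod (a n) < 1" and S: "0 \<le> S" and g: "1 \<le> g"
    and block: "(\<Sum>n\<in>{4 ^ k..<4 ^ Suc k}. (cmod (a n))\<^sup>2) \<le> S / g ^ k"
  defines "I \<equiv> {i. cell k q i \<inter> bad_block a k \<noteq> {}}"
  shows "finite I" "real (card I) \<le> S * (17 + 32 * sqrt (3 * S)) * (real k + 1) ^ 5 * (4 / g) ^ k"
proof -
  have range: "I \<subseteq> {- int (2 ^ k)..int (2 ^ k)}"
    using cell_index_range by (fastforce simp: I_def)
  then show "finite I" using finite_subset by blast
  define p r :: nat where "p = 4 ^ k" and "r = 4 ^ Suc k"
  define A where "A = (\<Sum>n\<in>{p..<r}. (cmod (a n))\<^sup>2)"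
  have A: "A \<le> S / g ^ k" "0 \<le> A" using block by (simp_all add: A_def p_def r_def sum_nonneg)
  \<comment> \<open>The decaying bound on \<open>A\<close> is kept for the outer factor. Inside the
    bracket the uniform one suffices, since the diagonal part \<open>3 * L\<close> is of order 4^k
    anyway.\<close>
  have "A \<le> S" 
  proof -
    have "S / g ^ k \<le> S / 1" using S g by (intro divide_left_mono) auto
    then show ?thesis using A(1) by simp
  qed
  have "\<forall>i\<in>I. \<exists>z. z \<in> cell k q i \<and> z \<in> bad_block a k" by (auto simp: I_def)
  then obtain Z where Z: "\<And>i. i \<in> I \<Longrightarrow> Z i \<in> cell k q i" "\<And>i. i \<in> I \<Longrightarrow> Z i \<in> bad_block a k" by metis
  define t where "t = 1 / (real k + 1)\<^sup>2"
  have "\<forall>i\<in>I. \<exists>m. p \<le> m \<and> m \<le> r \<and> t < cmod (\<Sum>n\<in>{p..<m}. a n * phase a (Z i) n)"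
    using Z(2) by (fastforce simp: bad_block_def t_def p_def r_def)
  then obtain m where m: "\<And>i. i \<in> I \<Longrightarrow> m i \<le> r"
    "\<And>i. i \<in> I \<Longrightarrow> t < cmod (\<Sum>n\<in>{p..<m i}. a n * phase a (Z i) n)" by metis
  have Z1: "cmod (Z i) = 1" if "i \<in> I" for i using Z(1)[OF that] by (simp add: cell_def)
  define L where "L = real (r - p)"
  have L: "L = 3 * 4 ^ k" by (simp add: L_def r_def p_def)
  \<comment> \<open>The 8 is 2 * 4: each phase drifts by at most 4 |a_n| per step, and the
    correlation bound doubles the drift.\<close>
  define B0 where "B0 = 2 + 8 * (\<Sum>n\<in>{p..<r}. cmod (a n))"
  define H where "H = (\<Sum>d=1..2 * 2 ^ k. 1 / real d)"
  have H: "0 \<le> H" "H \<le> real k + 2"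
    using harmonic_sum_pow2_le[of "Suc k"] by (simp_all add: H_def sum_nonneg)
  have B00: "0 \<le> B0" by (simp add: B0_def sum_nonneg)
  \<comment> \<open>The extra \<open>2 ^ k\<close> converts distances on the circle into differences
    of cell indices.\<close>
  have "real (card I) * t\<^sup>2 \<le> A * (3 * L + 2 * (2 ^ k * B0) * (\<Sum>d=1..2 * 2 ^ k. 1 / real d))"
    unfolding A_def L_def
  proof (rule large_sieve_count[OF range m(1), where x = "\<lambda>i. phase a (Z i)"])
    fix i j r' assume ij: "i \<in> I" "j \<in> I" "r' \<le> r" "2 \<le> \<bar>i - j\<bar>"
    have sep: "real_of_int \<bar>i - j\<bar> - 1 \<le> 2 ^ k * cmod (Z i - Z j)"
      by (rule cell_separation[OF Z(1)[OF ij(1)] Z(1)[OF ij(2)]])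
    have pos: "0 < real_of_int \<bar>i - j\<bar> - 1" using ij(4) by linarith
    then have ne: "0 < cmod (Z i - Z j)" using sep
      by (cases "cmod (Z i - Z j) = 0") auto
    have "cmod (\<Sum>n\<in>{p..<r'}. phase a (Z i) n * cnj (phase a (Z j) n)) \<le>
        (2 + 2 * (\<Sum>n\<in>{p..<r'}. 4 * cmod (a n))) / cmod (Z i - Z j)"
      using ne by (intro near_rotation_correlation norm_phase phase_Suc_approx a Z1 ij) auto
    also have "\<dots> \<le> B0 / cmod (Z i - Z j)"
    proof (rule divide_right_mono)
      have "(\<Sum>n\<in>{p..<r'}. cmod (a n)) \<le> (\<Sum>n\<in>{p..<r}. cmod (a n))"
        using ij(3) by (intro sum_mono2) auto
      then show "2 + 2 * (\<Sum>n\<in>{p..<r'}. 4 * cmod (a n)) \<le> B0"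
        by (simp add: B0_def flip: sum_distrib_left)
    qed simp
    also have "\<dots> = (2 ^ k * B0) / (2 ^ k * cmod (Z i - Z j))" by simp
    also have "\<dots> \<le> (2 ^ k * B0) / (real_of_int \<bar>i - j\<bar> - 1)"
      using sep pos B00 by (intro divide_left_mono) auto
    finally show "cmod (\<Sum>n\<in>{p..<r'}. phase a (Z i) n * cnj (phase a (Z j) n)) \<le>
        (2 ^ k * B0) / (real_of_int \<bar>i - j\<bar> - 1)" .
  next
    fix i assume "i \<in> I" then show "t \<le> cmod (\<Sum>n\<in>{p..<m i}. a n * phase a (Z i) n)"
      using m(2) less_imp_le by blast
  qed (use B00 in \<open>auto simp: t_def norm_phase a Z1\<close>)
  also have "\<dots> \<le> (S / g ^ k) * (4 ^ k * ((17 + 32 * sqrt (3 * S)) * (real k + 1)))"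
  proof (rule mult_mono[OF A(1)])
    \<comment> \<open>The total drift over a block of length 3 * 4^k is at most sqrt(3 S) 2^k. With
      the factor \<open>2 ^ k\<close> from the cell width, the correlations again have order
      4^k.\<close>
    have "(\<Sum>n\<in>{p..<r}. cmod (a n) * 1)\<^sup>2 \<le> A * (\<Sum>n\<in>{p..<r}. 1\<^sup>2)"
      unfolding A_def by (rule Cauchy_Schwarz_ineq_sum)
    also have "\<dots> = A * L" by (simp add: L_def)
    also have "\<dots> \<le> S * (3 * 4 ^ k)" unfolding L using \<open>A \<le> S\<close> by (intro mult_right_mono) auto
    finally have "(\<Sum>n\<in>{p..<r}. cmod (a n)) \<le> sqrt (S * (3 * 4 ^ k))"
      by (intro real_le_rsqrt) simp
    also have "\<dots> = sqrt (3 * S) * 2 ^ k"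
      by (simp add: real_sqrt_mult real_sqrt_power mult_ac)
    finally have "B0 \<le> 2 + 8 * (sqrt (3 * S) * 2 ^ k)" by (simp add: B0_def)
    also have "\<dots> \<le> 2 ^ k * (2 + 8 * sqrt (3 * S))" by (simp add: algebra_simps)
    finally have B0: "B0 \<le> 2 ^ k * (2 + 8 * sqrt (3 * S))" .
    have "2 ^ k * B0 * H \<le> (2 ^ k * (2 ^ k * (2 + 8 * sqrt (3 * S)))) * (real k + 2)"
      using B0 B00 H S by (intro mult_mono mult_left_mono) auto
    also have "\<dots> = 4 ^ k * ((2 + 8 * sqrt (3 * S)) * (real k + 2))"
      by (simp add: power_mult_distrib[symmetric] mult.assoc[symmetric])
    also have "\<dots> \<le> 4 ^ k * ((2 + 8 * sqrt (3 * S)) * (2 * (real k + 1)))"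
      using S by (intro mult_left_mono) auto
    \<comment> \<open>Here 9 comes from \<open>3 * L\<close>, and 8 + 32 sqrt(3 S) is 2 * 2 * (2 + 8
      sqrt(3 S)); the constant 17 is 9 + 8.\<close>
    finally have "3 * L + 2 * (2 ^ k * B0) * H \<le> 4 ^ k * 9 + 4 ^ k * ((8 + 32 * sqrt (3 * S)) * (real k + 1))"
      unfolding L by (simp add: algebra_simps)
    also have "\<dots> \<le> 4 ^ k * ((17 + 32 * sqrt (3 * S)) * (real k + 1))"
      by (simp add: algebra_simps)
    finally show "3 * L + 2 * (2 ^ k * B0) * (\<Sum>d=1..2 * 2 ^ k. 1 / real d) \<le>
        4 ^ k * ((17 + 32 * sqrt (3 * S)) * (real k + 1))" unfolding H_def .
  qed (use S g B00 in \<open>auto simp: L intro!: add_nonneg_nonneg mult_nonneg_nonneg sum_nonneg\<close>)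
  finally have "real (card I) * t\<^sup>2 * (real k + 1) ^ 4 \<le>
      (S / g ^ k) * (4 ^ k * ((17 + 32 * sqrt (3 * S)) * (real k + 1))) * (real k + 1) ^ 4"
    by (rule mult_right_mono) simp
  moreover have "t\<^sup>2 * (real k + 1) ^ 4 = 1"
    by (simp add: t_def power_divide flip: power_mult)
  moreover have "(S / g ^ k) * (4 ^ k * ((17 + 32 * sqrt (3 * S)) * (real k + 1))) * (real k + 1) ^ 4 =
      S * (17 + 32 * sqrt (3 * S)) * (real k + 1) ^ 5 * (4 / g) ^ k"
    by (simp add: power_divide eval_nat_numeral)
  ultimately show "real (card I) \<le> S * (17 + 32 * sqrt (3 * S)) * (real k + 1) ^ 5 * (4 / g) ^ k"
    by (simp add: mult.assoc)
qed

section \<open>Convergence of the covering series\<close>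

lemma power_powr_commute:
  fixes x :: real
  assumes "0 \<le> x"
  shows "(x ^ k) powr s = (x powr s) ^ k"
  using assms by (induction k) (auto simp: powr_mult)

text \<open>With y = r^(-1/6), the linear factor is O(y^k) by Bernoulli, so its fifth power uses up
  r^(5k/6) and leaves a geometric series of ratio r^(1/6) < 1.\<close>

lemma summable_poly_times_geometric:
  fixes r :: real
  assumes "0 < r" "r < 1"
  shows "summable (\<lambda>k. (real k + 1) ^ 5 * r ^ k)"
proof -
  define y where "y = r powr (- 1 / 6)"
  have y1: "1 < y" unfolding y_def using assms powr_less_mono2_neg[of "- 1 / 6" r 1] by simp
  define C where "C = 1 + 1 / (y - 1)"
  have b: "real k + 1 \<le> C * y ^ k" for k
  proof -
    have "1 + real k * (y - 1) \<le> (1 + (y - 1)) ^ k"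
      using y1 by (intro Bernoulli_inequality) auto
    then have "real k * (y - 1) \<le> y ^ k" by simp
    then have "real k \<le> y ^ k / (y - 1)" using y1 by (simp add: pos_le_divide_eq)
    moreover have "1 \<le> y ^ k" using y1 by simp
    ultimately show ?thesis by (simp add: C_def algebra_simps)
  qed
  have "y ^ 5 * r = r powr (1 / 6)"
  proof -
    have "y ^ 5 = r powr (real 5 * (- 1 / 6))" unfolding y_def by (rule powr_power) (use assms in auto)
    then have "y ^ 5 = r powr (- 5 / 6)" by simp
    then have "y ^ 5 * r = r powr (- 5 / 6) * r powr 1" using assms by simp
    also have "\<dots> = r powr (1 / 6)" by (simp only: powr_add[symmetric]) simp
    finally show ?thesis .
  qed
  moreover have "r powr (1 / 6) < 1" using assms powr_less_mono2[of "1/6" r 1] by simp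
  ultimately have q: "y ^ 5 * r < 1" "0 \<le> y ^ 5 * r" by simp_all
  show ?thesis
  proof (rule summable_comparison_test)
    show "\<exists>N. \<forall>k\<ge>N. norm ((real k + 1) ^ 5 * r ^ k) \<le> C ^ 5 * (y ^ 5 * r) ^ k"
    proof (intro exI allI impI)
      fix k :: nat
      have "(real k + 1) ^ 5 * r ^ k \<le> (C * y ^ k) ^ 5 * r ^ k"
        using assms b[of k] by (intro mult_right_mono power_mono) auto
      also have "\<dots> = C ^ 5 * (y ^ 5 * r) ^ k"
        by (simp add: power_mult_distrib power_mult[symmetric] mult.commute[of k])
      finally show "norm ((real k + 1) ^ 5 * r ^ k) \<le> C ^ 5 * (y ^ 5 * r) ^ k"
        using assms by simp
    qed
    show "summable (\<lambda>k. C ^ 5 * (y ^ 5 * r) ^ k)"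
      using q by (intro summable_mult summable_geometric) simp
  qed
qed

lemma summable_inverse_Suc_square: "summable (\<lambda>k. 1 / (real k + 1)\<^sup>2)"
  using summable_Suc_iff[of "\<lambda>n. 1 / (real n)\<^sup>2"] inverse_power_summable[of 2]
  by (simp add: inverse_eq_divide add.commute)

lemma summable_of_weighted:
  fixes b :: "nat \<Rightarrow> real"
  assumes "0 \<le> \<gamma>" "\<And>n. 0 \<le> b n" "summable (\<lambda>n. real n powr \<gamma> * b n)"
  shows "summable b"
proof (rule summable_comparison_test[OF _ assms(3)], intro exI allI impI)
  \<comment> \<open>The index 0 is left out: \<open>0 powr \<gamma> = 0\<close> gives no control of
    \<open>b 0\<close>.\<close>
  fix n :: nat assume "1 \<le> n"
  then have "1 \<le> real n powr \<gamma>" using assms(1) by (intro ge_one_powr_ge_zero) auto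
  then have "1 * b n \<le> real n powr \<gamma> * b n" using assms(2) by (intro mult_right_mono)
  then show "norm (b n) \<le> real n powr \<gamma> * b n" using assms(2)[of n] by simp
qed

lemma block_sum_le:
  fixes b :: "nat \<Rightarrow> real"
  assumes "0 \<le> \<gamma>" "\<And>n. 0 \<le> b n" "summable (\<lambda>n. real n powr \<gamma> * b n)"
  shows "(\<Sum>n\<in>{4 ^ k..<4 ^ Suc k}. b n) \<le> (\<Sum>n. real n powr \<gamma> * b n) / (4 powr \<gamma>) ^ k"
proof -
  have "(4 powr \<gamma>) ^ k * (\<Sum>n\<in>{4 ^ k..<4 ^ Suc k}. b n) \<le> (\<Sum>n\<in>{4 ^ k..<4 ^ Suc k}. real n powr \<gamma> * b n)"
    unfolding sum_distrib_left
  proof (rule sum_mono)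
    fix n :: nat assume "n \<in> {4 ^ k..<4 ^ Suc k}"
    then have "real (4 ^ k) \<le> real n" by (subst of_nat_le_iff) auto
    then have "real (4 ^ k) powr \<gamma> \<le> real n powr \<gamma>" using assms(1) by (intro powr_mono2) auto
    moreover have "real (4 ^ k) powr \<gamma> = (4 powr \<gamma>) ^ k"
      by (simp add: power_powr_commute)
    ultimately show "(4 powr \<gamma>) ^ k * b n \<le> real n powr \<gamma> * b n"
      using assms(2)[of n] by (intro mult_right_mono) auto
  qed
  also have "\<dots> \<le> (\<Sum>n. real n powr \<gamma> * b n)"
    by (rule sum_le_suminf[OF assms(3)]) (auto simp: assms(2))
  finally show ?thesis by (simp add: pos_le_divide_eq mult.commute)
qed

definition bounded_sol :: "(nat \<Rightarrow> complex) \<Rightarrow> complex \<Rightarrow> bool" where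
  "bounded_sol a z \<longleftrightarrow> (\<exists>C. \<forall>n. cmod (szego_sol a z n) \<le> C)"

lemma unbounded_sol_in_bad_blocks:
  assumes "\<And>n. cmod (a n) < 1" "cmod z = 1" "summable (\<lambda>n. (cmod (a n))\<^sup>2)"
    and "\<not> bounded_sol a z"
  shows "\<exists>\<^sub>\<infinity>k. z \<in> bad_block a k"
proof (rule ccontr)
  assume "\<not> ?thesis"
  then obtain K where K: "\<And>k. K \<le> k \<Longrightarrow> z \<notin> bad_block a k"
    unfolding INFM_nat_le by blast
  have "\<exists>B. \<forall>m. cmod (\<Sum>n<m. a n * phase a z n) \<le> B"
  proof (rule partial_sums_bounded_of_blocks[OF _ summable_inverse_Suc_square])
    fix k m :: nat assume "K \<le> k" "4 ^ k \<le> m" "m \<le> 4 ^ Suc k"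
    then show "cmod (\<Sum>n\<in>{4 ^ k..<m}. a n * phase a z n) \<le> 1 / (real k + 1)\<^sup>2"
      using K[of k] assms(2) by (fastforce simp: bad_block_def)
  qed
  then obtain B where "\<And>m. cmod (\<Sum>n<m. a n * phase a z n) \<le> B" by blast
  from szego_sol_bounded[OF assms(1-3) this] show False
    using assms(4) by (simp add: bounded_sol_def)
qed

text \<open>There are O((k+1)^5 4^(k(1-\<gamma>))) bad cells of diameter at most 3 * 2^-k, so the
  covering sums of exponent s converge as soon as s > 2(1-\<gamma>).\<close>

lemma hausdorff_dim_unbounded_sol:
  fixes a :: "nat \<Rightarrow> complex"
  assumes a: "\<And>n. cmod (a n) < 1" and \<gamma>: "0 < \<gamma>" "\<gamma> < 1"
    and sm: "summable (\<lambda>n. real n powr \<gamma> * (cmod (a n))\<^sup>2)"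
  shows "hausdorff_dim {z. cmod z = 1 \<and> \<not> (bounded_sol a z \<and> bounded_sol (\<lambda>n. - a n) z)}
    \<le> ennreal (2 * (1 - \<gamma>))" (is "hausdorff_dim ?U \<le> _")
proof -
  define S where "S = (\<Sum>n. real n powr \<gamma> * (cmod (a n))\<^sup>2)"
  define g where "g = 4 powr \<gamma>"
  define C where "C = S * (17 + 32 * sqrt (3 * S))"
  have S0: "0 \<le> S" unfolding S_def by (rule suminf_nonneg[OF sm]) simp
  have g1: "1 \<le> g" unfolding g_def using \<gamma> by (intro ge_one_powr_ge_zero) auto
  have blk: "(\<Sum>n\<in>{4 ^ k..<4 ^ Suc k}. (cmod (a n))\<^sup>2) \<le> S / g ^ k" for k
    unfolding S_def g_def by (rule block_sum_le[OF _ _ sm]) (use \<gamma> in auto)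
  have sq: "summable (\<lambda>n. (cmod (a n))\<^sup>2)"
    by (rule summable_of_weighted[OF _ _ sm]) (use \<gamma> in auto)
  \<comment> \<open>The two signs of the coefficients and the four rotations of the cells account
    for the factor 8 in \<open>cardF\<close>.\<close>
  define b :: "bool \<Rightarrow> nat \<Rightarrow> complex" where "b \<sigma> n = (if \<sigma> then a n else - a n)" for \<sigma> n
  have nb: "cmod (b \<sigma> n) = cmod (a n)" for \<sigma> n by (simp add: b_def)
  define J where "J k \<sigma> q = {i. cell k q i \<inter> bad_block (b \<sigma>) k \<noteq> {}}" for k \<sigma> q
  define F where "F k = (\<Union>\<sigma>. \<Union>q<4. cell k q ` J k \<sigma> q)" for k
  have J: "finite (J k \<sigma> q)" "real (card (J k \<sigma> q)) \<le> C * (real k + 1) ^ 5 * (4 / g) ^ k" for k \<sigma> q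
  proof -
    have *: "\<And>n. cmod (b \<sigma> n) < 1" "(\<Sum>n\<in>{4 ^ k..<4 ^ Suc k}. (cmod (b \<sigma> n))\<^sup>2) \<le> S / g ^ k"
      unfolding nb by (fact a, fact blk)
    show "finite (J k \<sigma> q)" unfolding J_def by (rule card_bad_cells(1)[OF *(1) S0 g1 *(2)])
    show "real (card (J k \<sigma> q)) \<le> C * (real k + 1) ^ 5 * (4 / g) ^ k"
      unfolding J_def C_def by (rule card_bad_cells(2)[OF *(1) S0 g1 *(2)])
  qed
  have cardF: "real (card (F k)) \<le> 8 * (C * (real k + 1) ^ 5 * (4 / g) ^ k)" for k
  proof -
    have c1: "card (\<Union>q<4. cell k q ` J k \<sigma> q) \<le> (\<Sum>q<4. card (J k \<sigma> q))" for \<sigma>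
    proof -
      have "card (\<Union>q<4. cell k q ` J k \<sigma> q) \<le> (\<Sum>q<4. card (cell k q ` J k \<sigma> q))"
        by (rule card_UN_le) simp
      also have "\<dots> \<le> (\<Sum>q<4. card (J k \<sigma> q))" by (intro sum_mono card_image_le J)
      finally show ?thesis .
    qed
    have "card (F k) \<le> (\<Sum>\<sigma>\<in>UNIV. card (\<Union>q<4. cell k q ` J k \<sigma> q))"
      unfolding F_def by (rule card_UN_le) simp
    also have "\<dots> \<le> (\<Sum>\<sigma>\<in>UNIV. \<Sum>q<4. card (J k \<sigma> q))" by (intro sum_mono c1)
    finally have "real (card (F k)) \<le> real (\<Sum>\<sigma>\<in>UNIV. \<Sum>q<4. card (J k \<sigma> q))"
      by (simp only: of_nat_le_iff)
    also have "\<dots> = (\<Sum>\<sigma>\<in>UNIV. \<Sum>q<4. real (card (J k \<sigma> q)))" by simp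
    also have "\<dots> \<le> (\<Sum>\<sigma>\<in>(UNIV::bool set). \<Sum>q<(4::nat). C * (real k + 1) ^ 5 * (4 / g) ^ k)"
      by (intro sum_mono J)
    finally show ?thesis by (simp add: card_UNIV_bool)
  qed
  have haus: "hausdorff_measure s ?U = 0" if s: "2 * (1 - \<gamma>) < s" for s
  proof (rule hausdorff_measure_limsup_zero[where F = F and d = "\<lambda>k. 3 * (1 / 2) ^ k"])
    show s0: "0 < s" using s \<gamma> by simp
    show "finite (F k)" for k using J(1) by (auto simp: F_def)
    show "bounded U" if U: "U \<in> F k" for k U
    proof -
      have "U \<subseteq> sphere 0 1" using U by (auto simp: F_def cell_def)
      then show ?thesis using bounded_subset bounded_sphere by blast
    qed
    show "diameter U \<le> 3 * (1 / 2) ^ k" if U: "U \<in> F k" for k U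
      using U cell_dist by (intro diameter_le) (auto simp: F_def power_divide)
    show "(\<lambda>k. 3 * (1 / 2) ^ k :: real) \<longlonglongrightarrow> 0"
      using tendsto_mult_right_zero[OF LIMSEQ_power_zero[of "1/2::real"], of 3] by simp
    \<comment> \<open>This is the ratio of the covering series: 4^(1-\<gamma>) from the number of
      cells times 2^-s from their size.\<close>
    define r where "r = 2 powr (2 * (1 - \<gamma>) - s)"
    have r: "0 < r" "r < 1" using s powr_less_mono[of "2 * (1 - \<gamma>) - s" 0 2] by (simp_all add: r_def)
    have rg: "(4 / g) * (1 / 2) powr s = r"
    proof -
      have "4 / g = 2 powr 2 / (2 powr 2) powr \<gamma>" by (simp add: g_def)
      also have "\<dots> = 2 powr (2 - 2 * \<gamma>)" by (simp only: powr_powr powr_diff)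
      finally have "4 / g = 2 powr (2 * (1 - \<gamma>))" by (simp add: right_diff_distrib)
      moreover have "(1 / 2) powr s = 2 powr (- s)" by (simp add: powr_divide powr_minus_divide)
      ultimately show ?thesis unfolding r_def by (simp flip: powr_add)
    qed
    show "summable (\<lambda>k. real (card (F k)) * (3 * (1 / 2) ^ k) powr s)"
    proof (rule summable_comparison_test)
      show "summable (\<lambda>k. 8 * C * 3 powr s * ((real k + 1) ^ 5 * r ^ k))"
        by (intro summable_mult summable_poly_times_geometric r)
      show "\<exists>N. \<forall>k\<ge>N. norm (real (card (F k)) * (3 * (1 / 2) ^ k) powr s) \<le>
          8 * C * 3 powr s * ((real k + 1) ^ 5 * r ^ k)"
      proof (intro exI allI impI)
        fix k :: nat
        have e: "(3 * (1 / 2) ^ k) powr s = 3 powr s * ((1 / 2) powr s) ^ k"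
          by (simp only: powr_mult power_powr_commute zero_le_divide_1_iff zero_le_numeral)
        have "real (card (F k)) * (3 * (1 / 2) ^ k) powr s \<le>
            (8 * (C * (real k + 1) ^ 5 * (4 / g) ^ k)) * (3 powr s * ((1 / 2) powr s) ^ k)"
          unfolding e by (rule mult_right_mono[OF cardF]) simp
        also have "\<dots> = 8 * C * 3 powr s * ((real k + 1) ^ 5 * ((4 / g) * (1 / 2) powr s) ^ k)"
          unfolding power_mult_distrib by (simp only: mult_ac)
        finally show "norm (real (card (F k)) * (3 * (1 / 2) ^ k) powr s) \<le>
            8 * C * 3 powr s * ((real k + 1) ^ 5 * r ^ k)" unfolding rg by simp
      qed
    qed
    show "\<exists>\<^sub>\<infinity>k. z \<in> \<Union>(F k)" if z: "z \<in> ?U" for z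
    proof -
      have z1: "cmod z = 1" using z by simp
      have bb: "b True = a" "b False = (\<lambda>n. - a n)" by (auto simp: b_def)
      obtain \<sigma> where \<sigma>: "\<not> bounded_sol (b \<sigma>) z" using z bb[symmetric] by auto
      have "\<exists>\<^sub>\<infinity>k. z \<in> bad_block (b \<sigma>) k"
        using \<sigma> z1 sq a by (intro unbounded_sol_in_bad_blocks) (auto simp: nb)
      then show ?thesis
      proof (rule INFM_mono)
        fix k assume k: "z \<in> bad_block (b \<sigma>) k"
        obtain q i where "q < 4" "z \<in> cell k q i" using ex_cell[OF z1] by blast
        with k show "z \<in> \<Union>(F k)" unfolding F_def J_def by blast
      qed
    qed
  qed
  show ?thesis
  \<comment> \<open>At the critical exponent itself the series need not converge, so the dimension
    is bounded through larger exponents.\<close>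
  proof (rule ennreal_le_epsilon)
    fix e :: real assume e: "0 < e"
    have "hausdorff_dim ?U \<le> ennreal (2 * (1 - \<gamma>) + e)"
      unfolding hausdorff_dim_def using haus[of "2 * (1 - \<gamma>) + e"] e \<gamma>
      by (intro Inf_lower CollectI exI[of _ "2 * (1 - \<gamma>) + e"]) simp
    then show "hausdorff_dim ?U \<le> ennreal (2 * (1 - \<gamma>)) + ennreal e"
      using e \<gamma> by (simp add: ennreal_plus)
  qed
qed

section \<open>Orthogonal polynomials\<close>

lemma norm_one_mult_cnj:
  assumes "cmod z = 1"
  shows "z * cnj z = 1" "cnj z * z = 1"
  using assms complex_norm_square[of z] by (auto simp: mult.commute)

locale circle_measure =
  fixes \<mu> :: "complex measure"
  assumes nontrivial: "nontrivial_circle_measure \<mu>"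
begin

sublocale prob_space \<mu>
  using nontrivial by (simp add: nontrivial_circle_measure_def)

lemma sets_mu: "sets \<mu> = sets (restrict_space borel unit_circle)"
  using nontrivial by (simp add: nontrivial_circle_measure_def)

lemma space_mu: "space \<mu> = unit_circle"
  using sets_eq_imp_space_eq[OF sets_mu] by (simp add: space_restrict_space)

lemma integrable_continuous:
  fixes f :: "complex \<Rightarrow> 'b :: {second_countable_topology, banach}"
  assumes "continuous_on UNIV f"
  shows "integrable \<mu> f"
proof -
  have "f \<in> borel_measurable borel" using assms by (rule borel_measurable_continuous_onI)
  then have "f \<in> borel_measurable \<mu>"
    unfolding measurable_cong_sets[OF sets_mu refl] by (rule measurable_restrict_space1)
  moreover have "compact (f ` unit_circle)"
    using assms by (intro compact_continuous_image) (auto intro: continuous_on_subset)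
  then obtain B where "\<And>z. z \<in> unit_circle \<Longrightarrow> norm (f z) \<le> B"
    using compact_imp_bounded[of "f ` unit_circle"] by (force simp: bounded_iff)
  then have "AE z in \<mu>. norm (f z) \<le> B"
    by (intro AE_I2) (simp add: space_mu)
  ultimately show ?thesis by (intro integrable_const_bound)
qed

abbreviation ip where "ip \<equiv> poly_inner \<mu>"

lemma ip_integrable: "integrable \<mu> (\<lambda>z. cnj (poly P z) * poly Q z)"
  by (intro integrable_continuous continuous_intros)

lemma ip_add_right: "ip P (Q + R) = ip P Q + ip P R"
  by (simp add: poly_inner_def distrib_left ip_integrable)

lemma ip_diff_right: "ip P (Q - R) = ip P Q - ip P R"
  by (simp add: poly_inner_def right_diff_distrib ip_integrable)

lemma ip_smult_right: "ip P (smult c Q) = c * ip P Q"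
  by (simp add: poly_inner_def mult.left_commute)

lemma ip_cnj: "cnj (ip P Q) = ip Q P"
proof -
  have "cnj (ip P Q) = (\<integral>z. cnj (cnj (poly P z) * poly Q z) \<partial>\<mu>)"
    unfolding poly_inner_def by (simp only: complex_cnj_mult flip: Bochner_Integration.integral_cnj)
  then show ?thesis by (simp add: poly_inner_def mult.commute)
qed

lemma ip_zero [simp]: "ip P 0 = 0" "ip 0 P = 0"
  by (simp_all add: poly_inner_def)

lemma ip_sum_right: "ip P (\<Sum>k\<in>A. Q k) = (\<Sum>k\<in>A. ip P (Q k))"
  by (induction A rule: infinite_finite_induct) (auto simp: ip_add_right)

lemma ip_add_left: "ip (P + Q) R = ip P R + ip Q R"
  by (metis ip_add_right ip_cnj complex_cnj_add)

lemma ip_smult_left: "ip (smult c P) Q = cnj c * ip P Q"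
  by (metis ip_smult_right ip_cnj complex_cnj_mult)

lemma ip_sum_left: "ip (\<Sum>k\<in>A. Q k) P = (\<Sum>k\<in>A. ip (Q k) P)"
  by (induction A rule: infinite_finite_induct) (auto simp: ip_add_left)

lemma ip_self: "ip P P = of_real (\<integral>z. (cmod (poly P z))\<^sup>2 \<partial>\<mu>)"
proof -
  have "ip P P = (\<integral>z. complex_of_real ((cmod (poly P z))\<^sup>2) \<partial>\<mu>)"
    unfolding poly_inner_def complex_norm_square by (simp add: mult.commute)
  then show ?thesis by (simp only: integral_complex_of_real)
qed

lemma L2_norm_sq: "(poly_L2_norm \<mu> P)\<^sup>2 = (\<integral>z. (cmod (poly P z))\<^sup>2 \<partial>\<mu>)"
  unfolding poly_L2_norm_def by (intro real_sqrt_pow2 integral_nonneg_AE) simp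

lemma ip_self_norm: "ip P P = of_real ((poly_L2_norm \<mu> P)\<^sup>2)"
  by (simp only: ip_self L2_norm_sq)

lemma L2_norm_nonneg: "0 \<le> poly_L2_norm \<mu> P"
  unfolding poly_L2_norm_def by (simp add: integral_nonneg_AE)

text \<open>Otherwise \<open>P\<close> would vanish almost everywhere, and its finitely many roots
  on the circle would carry all of the measure, against nontriviality.\<close>

lemma ip_self_eq_0:
  assumes "ip P P = 0"
  shows "P = 0"
proof (rule ccontr)
  assume P: "P \<noteq> 0"
  define F where "F = {z. poly P z = 0} \<inter> unit_circle"
  have fin: "finite F" unfolding F_def using poly_roots_finite[OF P] by simp
  have "(\<integral>z. (cmod (poly P z))\<^sup>2 \<partial>\<mu>) = 0" using assms by (simp add: ip_self)
  moreover have "integrable \<mu> (\<lambda>z. (cmod (poly P z))\<^sup>2)"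
    by (intro integrable_continuous continuous_intros)
  ultimately have "AE z in \<mu>. (cmod (poly P z))\<^sup>2 = 0"
    using integral_nonneg_eq_0_iff_AE[of \<mu> "\<lambda>z. (cmod (poly P z))\<^sup>2"] by simp
  then have ae: "AE z in \<mu>. z \<in> F"
    by (rule AE_mp) (rule AE_I2, simp add: F_def space_mu)
  have "closed F" using fin by (rule finite_imp_closed)
  then have Fs: "F \<in> sets \<mu>"
    unfolding sets_mu by (subst sets_restrict_space_iff) (auto simp: F_def)
  have "emeasure \<mu> (space \<mu> - F) = 0"
    using ae Fs by (subst (asm) AE_iff_measurable[of "space \<mu> - F"]) auto
  then have "supported_by \<mu> F" using Fs by (simp add: supported_by_def)
  then show False using fin nontrivial by (auto simp: nontrivial_circle_measure_def)
qed

lemma ip_cong_circle: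
  assumes "\<And>z. cmod z = 1 \<Longrightarrow> cnj (poly P z) * poly Q z = cnj (poly P' z) * poly Q' z"
  shows "ip P Q = ip P' Q'"
  unfolding poly_inner_def by (rule Bochner_Integration.integral_cong) (auto simp: space_mu assms)

lemma ip_pCons_0: "ip (pCons 0 P) (pCons 0 Q) = ip P Q"
proof (rule ip_cong_circle)
  fix z :: complex assume "cmod z = 1"
  then have "cnj z * z = 1" by (rule norm_one_mult_cnj)
  moreover have "cnj (poly (pCons 0 P) z) * poly (pCons 0 Q) z =
      (cnj z * z) * (cnj (poly P z) * poly Q z)" by (simp add: mult_ac)
  ultimately show "cnj (poly (pCons 0 P) z) * poly (pCons 0 Q) z = cnj (poly P z) * poly Q z"
    by simp
qed

lemma poly_szego_dual_circle:
  assumes "cmod z = 1"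
  shows "poly (szego_dual P) z = z ^ degree P * cnj (poly P z)"
proof -
  have "z \<noteq> 0" "1 / cnj z = z"
    using assms norm_one_mult_cnj[OF assms] by (auto simp: eq_divide_eq mult.commute split: if_splits intro!: divide_eq_eq[THEN iffD2])
  then show ?thesis using poly_szego_dual[of z P] by simp
qed

lemma ip_eq_0_if_monom:
  assumes "\<And>k. coeff P k \<noteq> 0 \<Longrightarrow> ip (monom 1 k) Q = 0"
  shows "ip P Q = 0"
proof -
  have "ip (\<Sum>k\<le>degree P. monom (coeff P k) k) Q = (\<Sum>k\<le>degree P. cnj (coeff P k) * ip (monom 1 k) Q)"
    unfolding ip_sum_left by (rule sum.cong) (auto simp: ip_smult_left[symmetric] smult_monom)
  also have "\<dots> = 0" using assms by (intro sum.neutral) auto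
  finally show ?thesis by (simp only: poly_as_sum_of_monoms)
qed

section \<open>From Gram-Schmidt to the Szego recursion\<close>

text \<open>The claims are proved together: a leading coefficient 1 makes the earlier polynomials
  nonzero, hence the Gram-Schmidt denominators nonzero, and this is what yields
  orthogonality.\<close>

lemma monic_op_props: "degree (monic_op \<mu> n) = n \<and> coeff (monic_op \<mu> n) n = 1 \<and>
    (\<forall>k<n. ip (monic_op \<mu> k) (monic_op \<mu> n) = 0)"
proof (induction n rule: less_induct)
  case (less n)
  let ?\<Phi> = "monic_op \<mu>"
  let ?S = "\<Sum>k<n. smult (ip (?\<Phi> k) (monom 1 n) / ip (?\<Phi> k) (?\<Phi> k)) (?\<Phi> k)"
  have S0: "coeff ?S i = 0" if "n \<le> i" for i
    unfolding coeff_sum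
  proof (intro sum.neutral ballI)
    fix k assume "k \<in> {..<n}"
    then have "coeff (?\<Phi> k) i = 0" using less that by (intro coeff_eq_0) auto
    then show "coeff (smult (ip (?\<Phi> k) (monom 1 n) / ip (?\<Phi> k) (?\<Phi> k)) (?\<Phi> k)) i = 0" by simp
  qed
  have eq: "?\<Phi> n = monom 1 n - ?S" by (rule monic_op.simps)
  have c1: "coeff (?\<Phi> n) n = 1" using S0[of n] by (simp add: eq)
  have "degree (?\<Phi> n) \<le> n"
  proof (rule degree_le, intro allI impI)
    fix i assume "n < i"
    then show "coeff (?\<Phi> n) i = 0" using S0[of i] by (simp add: eq)
  qed
  then have deg: "degree (?\<Phi> n) = n" using c1 by (intro antisym le_degree) auto
  have "ip (?\<Phi> j) (?\<Phi> n) = 0" if j: "j < n" for j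
  proof -
    have orth: "ip (?\<Phi> j) (?\<Phi> k) = 0" if "k < n" "k \<noteq> j" for k
    proof (cases "j < k")
      case True then show ?thesis using less \<open>k < n\<close> by blast
    next
      case False
      then have "ip (?\<Phi> k) (?\<Phi> j) = 0" using less j \<open>k \<noteq> j\<close> by (meson linorder_neqE_nat)
      then show ?thesis using ip_cnj[of "?\<Phi> k" "?\<Phi> j"] by simp
    qed
    have "?\<Phi> j \<noteq> 0" using less j by force
    then have ne: "ip (?\<Phi> j) (?\<Phi> j) \<noteq> 0" using ip_self_eq_0 by blast
    have "ip (?\<Phi> j) ?S = (\<Sum>k<n. if k = j then ip (?\<Phi> j) (monom 1 n) else 0)"
      unfolding ip_sum_right by (rule sum.cong) (auto simp: ip_smult_right orth ne)
    also have "\<dots> = ip (?\<Phi> j) (monom 1 n)" using j by simp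
    finally show ?thesis unfolding eq by (simp add: ip_diff_right)
  qed
  then show ?case using deg c1 by blast
qed

lemma degree_monic_op: "degree (monic_op \<mu> n) = n"
  and coeff_monic_op: "coeff (monic_op \<mu> n) n = 1"
  and monic_op_orthogonal: "k < n \<Longrightarrow> ip (monic_op \<mu> k) (monic_op \<mu> n) = 0"
  using monic_op_props[of n] by auto

lemma monic_op_nonzero: "monic_op \<mu> n \<noteq> 0"
  using coeff_monic_op[of n] by force

text \<open>Induction on the bound \<open>m\<close>, removing the top coefficient with a multiple of
  the monic polynomial of that degree. Bounding coefficients rather than the degree lets
  \<open>m = 0\<close> express \<open>Q = 0\<close>.\<close>

lemma monic_op_orthogonal_lower:
  assumes "\<And>i. m \<le> i \<Longrightarrow> coeff Q i = 0" "m \<le> n"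
  shows "ip Q (monic_op \<mu> n) = 0"
  using assms
proof (induction m arbitrary: Q)
  case 0
  then have "Q = 0" by (intro poly_eqI) simp
  then show ?case by simp
next
  case (Suc m)
  define R where "R = Q - smult (coeff Q m) (monic_op \<mu> m)"
  have "ip R (monic_op \<mu> n) = 0"
  proof (rule Suc.IH)
    fix i assume i: "m \<le> i"
    show "coeff R i = 0"
    proof (cases "i = m")
      case True then show ?thesis by (simp add: R_def coeff_monic_op)
    next
      case False
      then have "coeff (monic_op \<mu> m) i = 0" using i by (intro coeff_eq_0) (simp add: degree_monic_op)
      then show ?thesis using Suc.prems(1)[of i] i False by (simp add: R_def)
    qed
  qed (use Suc in simp)
  moreover have "Q = R + smult (coeff Q m) (monic_op \<mu> m)" by (simp add: R_def)
  then have "ip Q (monic_op \<mu> n) = ip R (monic_op \<mu> n) + cnj (coeff Q m) * ip (monic_op \<mu> m) (monic_op \<mu> n)"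
    by (metis ip_add_left ip_smult_left)
  ultimately show ?case using monic_op_orthogonal[of m n] Suc.prems by simp
qed

lemma ip_monom_monic_op: "k < n \<Longrightarrow> ip (monom 1 k) (monic_op \<mu> n) = 0"
  by (rule monic_op_orthogonal_lower[of n]) auto

text \<open>On the circle, z^-k z^n cnj(P) = cnj(P) z^(n-k): dualising turns orthogonality to 1,
  ..., z^(n-1) into orthogonality to z, ..., z^n.\<close>

lemma ip_monom_szego_dual:
  assumes "1 \<le> k" "k \<le> n"
  shows "ip (monom 1 k) (szego_dual (monic_op \<mu> n)) = 0"
proof -
  have "ip (monom 1 k) (szego_dual (monic_op \<mu> n)) = ip (monic_op \<mu> n) (monom 1 (n - k))"
  proof (rule ip_cong_circle)
    fix z :: complex assume z: "cmod z = 1"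
    have "z ^ n = z ^ k * z ^ (n - k)" using assms by (simp flip: power_add)
    then have "cnj z ^ k * z ^ n = (cnj z * z) ^ k * z ^ (n - k)" by (simp add: power_mult_distrib)
    then have "cnj z ^ k * z ^ n = z ^ (n - k)" by (simp add: norm_one_mult_cnj[OF z])
    then show "cnj (poly (monom 1 k) z) * poly (szego_dual (monic_op \<mu> n)) z =
        cnj (poly (monic_op \<mu> n) z) * poly (monom 1 (n - k)) z"
      by (simp add: poly_szego_dual_circle[OF z] degree_monic_op poly_monom mult.assoc[symmetric] mult.commute)
  qed
  also have "\<dots> = cnj (ip (monom 1 (n - k)) (monic_op \<mu> n))" by (simp only: ip_cnj)
  also have "\<dots> = 0" using assms by (simp add: ip_monom_monic_op)
  finally show ?thesis .
qed

text \<open>The polynomial \<open>z \<Phi>\<^sub>n - \<Phi>\<^bsub>n+1\<^esub>\<close> has degree at most \<open>n\<close> and is orthogonal to \<open>z, \<dots>, z\<^sup>n\<close>, hence is a multiple of \<open>\<Phi>\<^sub>n\<^sup>*\<close>.\<close>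

lemma szego_recursion_ex:
  "\<exists>c. cmod c < 1 \<and> monic_op \<mu> (Suc n) = pCons 0 (monic_op \<mu> n) - smult c (szego_dual (monic_op \<mu> n)) \<and>
     (poly_L2_norm \<mu> (monic_op \<mu> (Suc n)))\<^sup>2 = (1 - (cmod c)\<^sup>2) * (poly_L2_norm \<mu> (monic_op \<mu> n))\<^sup>2"
proof -
  let ?\<Phi> = "monic_op \<mu> n" and ?\<Psi> = "monic_op \<mu> (Suc n)"
  let ?S = "szego_dual ?\<Phi>"
  define D where "D = pCons 0 ?\<Phi> - ?\<Psi>"
  \<comment> \<open>The dual has constant term 1, so this choice removes the constant term of
    \<open>R\<close>; then \<open>R\<close> lies in the span of z, ..., z^n and is orthogonal to
    that span.\<close>
  define c where "c = coeff D 0"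
  define R where "R = D - smult c ?S"
  have cS: "coeff ?S i = 0" if "n < i" for i
    using that by (simp add: coeff_szego_dual degree_monic_op)
  have S0: "coeff ?S 0 = 1" by (simp add: coeff_szego_dual degree_monic_op coeff_monic_op)
  have cD: "coeff D i = 0" if "n < i" for i
  proof (cases "i = Suc n")
    case True then show ?thesis by (simp add: D_def coeff_monic_op)
  next
    case False
    obtain j where j: "i = Suc j" using \<open>n < i\<close> less_imp_Suc_add by blast
    have "n < j" using that False j by simp
    with j have j: "i = Suc j" "n < j" by auto
    then show ?thesis by (simp add: D_def coeff_eq_0 degree_monic_op)
  qed
  have "ip R R = 0"
  proof (rule ip_eq_0_if_monom)
    fix k assume k: "coeff R k \<noteq> 0"
    have "coeff R 0 = 0" by (simp add: R_def c_def S0)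
    then have "1 \<le> k" using k by (cases k) auto
    have "k \<le> n" using k cD cS by (force simp: R_def not_le[symmetric])
    obtain j where j: "k = Suc j" using \<open>1 \<le> k\<close> by (cases k) auto
    have "ip (monom 1 k) (pCons 0 ?\<Phi>) = ip (monom 1 j) ?\<Phi>"
      unfolding j monom_Suc by (rule ip_pCons_0)
    also have "\<dots> = 0" using j \<open>k \<le> n\<close> by (intro ip_monom_monic_op) simp
    finally have "ip (monom 1 k) (pCons 0 ?\<Phi>) = 0" .
    then show "ip (monom 1 k) R = 0"
      using \<open>1 \<le> k\<close> \<open>k \<le> n\<close>
      by (simp add: R_def D_def ip_diff_right ip_smult_right ip_monom_monic_op ip_monom_szego_dual)
  qed
  then have "R = 0" by (rule ip_self_eq_0)
  then have rec: "?\<Psi> = pCons 0 ?\<Phi> - smult c ?S" by (simp add: R_def D_def algebra_simps)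
  \<comment> \<open>The norm identity is Pythagoras for this orthogonal decomposition:
    multiplication by z and dualising both preserve the norm.\<close>
  then have zP: "pCons 0 ?\<Phi> = ?\<Psi> + smult c ?S" by simp
  have S\<Psi>: "ip ?S ?\<Psi> = 0" using cS by (intro monic_op_orthogonal_lower[of "Suc n"]) auto
  then have \<Psi>S: "ip ?\<Psi> ?S = 0" using ip_cnj[of ?S ?\<Psi>] by simp
  have SS: "ip ?S ?S = ip ?\<Phi> ?\<Phi>"
  proof (rule ip_cong_circle)
    fix z :: complex assume z: "cmod z = 1"
    have "cnj z ^ n * z ^ n = 1" by (simp add: norm_one_mult_cnj[OF z] flip: power_mult_distrib)
    moreover have "cnj (poly ?S z) * poly ?S z = (cnj z ^ n * z ^ n) * (cnj (poly ?\<Phi> z) * poly ?\<Phi> z)"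
      by (simp add: poly_szego_dual_circle[OF z] degree_monic_op mult_ac)
    ultimately show "cnj (poly ?S z) * poly ?S z = cnj (poly ?\<Phi> z) * poly ?\<Phi> z" by simp
  qed
  have "ip ?\<Phi> ?\<Phi> = ip (pCons 0 ?\<Phi>) (pCons 0 ?\<Phi>)" by (simp only: ip_pCons_0)
  also have "\<dots> = ip ?\<Psi> ?\<Psi> + cnj c * c * ip ?\<Phi> ?\<Phi>"
    unfolding zP by (simp add: ip_add_left ip_add_right ip_smult_left ip_smult_right S\<Psi> \<Psi>S SS)
  also have "cnj c * c = of_real ((cmod c)\<^sup>2)" by (simp only: complex_norm_square mult.commute)
  finally have "complex_of_real ((poly_L2_norm \<mu> ?\<Phi>)\<^sup>2) =
      of_real ((poly_L2_norm \<mu> ?\<Psi>)\<^sup>2 + (cmod c)\<^sup>2 * (poly_L2_norm \<mu> ?\<Phi>)\<^sup>2)"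
    unfolding ip_self_norm by simp
  then have norm: "(poly_L2_norm \<mu> ?\<Psi>)\<^sup>2 = (1 - (cmod c)\<^sup>2) * (poly_L2_norm \<mu> ?\<Phi>)\<^sup>2"
    unfolding of_real_eq_iff by (simp add: algebra_simps)
  have "poly_L2_norm \<mu> P \<noteq> 0" if "P \<noteq> 0" for P
    using ip_self_eq_0[of P] that by (auto simp: ip_self_norm)
  \<comment> \<open>Strict positivity of the next norm is what forces |c| < 1.\<close>
  then have "0 < (poly_L2_norm \<mu> ?\<Psi>)\<^sup>2" using monic_op_nonzero by simp
  then have "0 < 1 - (cmod c)\<^sup>2" unfolding norm by (simp add: zero_less_mult_iff)
  then have "cmod c < 1" by (simp add: abs_square_less_1)
  with rec norm show ?thesis by blast
qed

lemma L2_norm_pos: "P \<noteq> 0 \<Longrightarrow> 0 < poly_L2_norm \<mu> P"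
  using ip_self_eq_0[of P] L2_norm_nonneg[of P] by (auto simp: ip_self_norm less_le)

text \<open>Existence comes from \<open>szego_recursion_ex\<close>; uniqueness, needed to unfold the
  definite description, from the constant coefficient, which equals minus the conjugate of the
  Verblunsky coefficient.\<close>

lemma
  shows norm_verblunsky_less_1: "cmod (verblunsky \<mu> n) < 1"
    and monic_op_Suc: "monic_op \<mu> (Suc n) =
      pCons 0 (monic_op \<mu> n) - smult (cnj (verblunsky \<mu> n)) (szego_dual (monic_op \<mu> n))"
    and L2_norm_monic_op_Suc: "poly_L2_norm \<mu> (monic_op \<mu> (Suc n)) =
      sqrt (1 - (cmod (verblunsky \<mu> n))\<^sup>2) * poly_L2_norm \<mu> (monic_op \<mu> n)"
proof -
  let ?\<Phi> = "monic_op \<mu> n" and ?\<Psi> = "monic_op \<mu> (Suc n)"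
  obtain c where c: "cmod c < 1" "?\<Psi> = pCons 0 ?\<Phi> - smult c (szego_dual ?\<Phi>)"
    "(poly_L2_norm \<mu> ?\<Psi>)\<^sup>2 = (1 - (cmod c)\<^sup>2) * (poly_L2_norm \<mu> ?\<Phi>)\<^sup>2"
    using szego_recursion_ex by blast
  have S0: "coeff (szego_dual ?\<Phi>) 0 = 1"
    by (simp add: coeff_szego_dual degree_monic_op coeff_monic_op)
  have v: "verblunsky \<mu> n = cnj c"
    unfolding verblunsky_def
  proof (rule the_equality)
    show "cmod (cnj c) < 1 \<and> ?\<Psi> = pCons 0 ?\<Phi> - smult (cnj (cnj c)) (szego_dual ?\<Phi>)"
      using c by simp
    fix a assume "cmod a < 1 \<and> ?\<Psi> = pCons 0 ?\<Phi> - smult (cnj a) (szego_dual ?\<Phi>)"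
    then have "coeff ?\<Psi> 0 = - cnj a" using S0 by simp
    moreover have "coeff ?\<Psi> 0 = - c" using c(2) S0 by simp
    ultimately show "a = cnj c" by (metis complex_cnj_cnj neg_equal_iff_equal)
  qed
  show "cmod (verblunsky \<mu> n) < 1" using c(1) v by simp
  show "?\<Psi> = pCons 0 ?\<Phi> - smult (cnj (verblunsky \<mu> n)) (szego_dual ?\<Phi>)" using c(2) v by simp
  have "poly_L2_norm \<mu> ?\<Psi> = sqrt ((1 - (cmod c)\<^sup>2) * (poly_L2_norm \<mu> ?\<Phi>)\<^sup>2)"
    using c(3) L2_norm_nonneg by (metis real_sqrt_unique)
  then show "poly_L2_norm \<mu> ?\<Psi> = sqrt (1 - (cmod (verblunsky \<mu> n))\<^sup>2) * poly_L2_norm \<mu> ?\<Phi>"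
    using L2_norm_nonneg by (simp add: real_sqrt_mult v)
qed

lemma poly_orthonormal_op_circle:
  assumes z: "cmod z = 1"
  shows "poly (orthonormal_op \<mu> n) z = szego_sol (verblunsky \<mu>) z n"
proof (induction n)
  case 0
  have "monic_op \<mu> 0 = 1" by (simp add: monic_op.simps[of \<mu> 0])
  then show ?case by (simp add: orthonormal_op_def poly_L2_norm_def prob_space)
next
  case (Suc n)
  let ?\<Phi> = "monic_op \<mu> n" and ?a = "verblunsky \<mu> n" and ?L = "poly_L2_norm \<mu> (monic_op \<mu> n)"
  have L: "?L > 0" using L2_norm_pos[OF monic_op_nonzero] .
  have "poly (orthonormal_op \<mu> (Suc n)) z = (z * poly ?\<Phi> z - cnj ?a * (z ^ n * cnj (poly ?\<Phi> z))) /
      (of_real (sqrt (1 - (cmod ?a)\<^sup>2)) * of_real ?L)"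
    unfolding orthonormal_op_def L2_norm_monic_op_Suc
    by (simp add: monic_op_Suc poly_szego_dual_circle[OF z] degree_monic_op)
  also have "\<dots> = (z * poly (orthonormal_op \<mu> n) z - cnj ?a * z ^ n * cnj (poly (orthonormal_op \<mu> n) z)) /
      of_real (sqrt (1 - (cmod ?a)\<^sup>2))"
    using L by (simp add: orthonormal_op_def field_simps)
  finally show ?case by (simp add: Suc)
qed

lemma poly_second_kind_circle:
  assumes z: "cmod z = 1"
  shows "poly (second_kind (verblunsky \<mu>) n) z = szego_sol (\<lambda>n. - verblunsky \<mu> n) z n"
proof (induction n)
  case (Suc n)
  have "degree (second_kind (verblunsky \<mu>) n) = n"
    using degree_second_kind norm_verblunsky_less_1 by blast
  then show ?case using Suc by (simp add: poly_szego_dual_circle[OF z] mult.assoc)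
qed simp

lemma orthonormal_op_orthonormal:
  "ip (orthonormal_op \<mu> j) (orthonormal_op \<mu> k) = (if j = k then 1 else 0)"
proof -
  have L: "poly_L2_norm \<mu> (monic_op \<mu> k) > 0" for k using L2_norm_pos[OF monic_op_nonzero] .
  have "ip (monic_op \<mu> j) (monic_op \<mu> k) = 0" if "j \<noteq> k"
  proof (cases "j < k")
    case False
    then show ?thesis using monic_op_orthogonal[of k j] ip_cnj[of "monic_op \<mu> k" "monic_op \<mu> j"] that by simp
  qed (rule monic_op_orthogonal)
  then show ?thesis
    using L[of k] by (auto simp: orthonormal_op_def ip_smult_left ip_smult_right ip_self_norm power2_eq_square)
qed

end

section \<open>Variation of constants\<close>

lemma rho_square:
  assumes "cmod a < 1"
  shows "complex_of_real (sqrt (1 - (cmod a)\<^sup>2)) * of_real (sqrt (1 - (cmod a)\<^sup>2)) = 1 - a * cnj a"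
    "1 - a * cnj a \<noteq> 0"
proof -
  have "0 < 1 - (cmod a)\<^sup>2" by (rule rho_pos(1)[OF assms])
  then have "sqrt (1 - (cmod a)\<^sup>2) * sqrt (1 - (cmod a)\<^sup>2) = 1 - (cmod a)\<^sup>2" by simp
  moreover have e: "1 - a * cnj a = complex_of_real (1 - (cmod a)\<^sup>2)"
    by (simp only: complex_norm_square of_real_diff of_real_1)
  ultimately show "complex_of_real (sqrt (1 - (cmod a)\<^sup>2)) * of_real (sqrt (1 - (cmod a)\<^sup>2)) = 1 - a * cnj a"
    by (simp only: flip: of_real_mult)
  show "1 - a * cnj a \<noteq> 0" unfolding e using \<open>0 < 1 - (cmod a)\<^sup>2\<close> by (simp only: of_real_eq_0_iff)
qed

text \<open>\<open>H\<close> solves the recursion at \<open>w\<close> with coefficients \<open>a\<close>, and \<open>G\<close> solves it at \<open>z\<close> with coefficients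
  \<open>-e a\<close>, where \<open>e = \<plusminus>1\<close>. For \<open>e = 1\<close> and \<open>w = z\<close> this is the constancy of the Wronskian.\<close>

lemma bilinear_step:
  fixes a z w e H G :: complex and k :: nat
  assumes a: "cmod a < 1" and z: "cmod z = 1" and w: "cmod w = 1" and e: "e * e = 1" "cnj e = e"
  defines "\<rho> \<equiv> of_real (sqrt (1 - (cmod a)\<^sup>2))"
  defines "H' \<equiv> (w * H - cnj a * w ^ k * cnj H) / \<rho>"
    and "G' \<equiv> (z * G + e * cnj a * z ^ k * cnj G) / \<rho>"
  shows "H' * cnj G' + e * (w * cnj z) ^ Suc k * cnj H' * G' =
    w * cnj z * H * cnj G + e * (w * cnj z) ^ k * cnj H * G"
proof -
  note r = rho_square[OF a, folded \<rho>_def]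
  have r0: "\<rho> \<noteq> 0" using r by (metis mult_zero_left)
  have rc: "cnj \<rho> = \<rho>" by (simp add: \<rho>_def)
  define W V Z Y where "W = w ^ k" and "V = cnj w ^ k" and "Z = z ^ k" and "Y = cnj z ^ k"
  have WV: "W * V = 1" "Z * Y = 1"
    by (simp_all add: W_def V_def Z_def Y_def norm_one_mult_cnj(1) z w flip: power_mult_distrib)
  note zw = norm_one_mult_cnj(1)[OF z] norm_one_mult_cnj(1)[OF w]
  \<comment> \<open>With conjugates and powers as independent letters, tied only by
    \<open>W * V = 1\<close>, \<open>Z * Y = 1\<close>, \<open>z * u = 1\<close>,
    \<open>w * v = 1\<close> and \<open>e * e = 1\<close>, the claim is a polynomial
    identity.\<close>
  define b u v K L where "b = cnj a" and "u = cnj z" and "v = cnj w" and "K = cnj H" and "L = cnj G"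
  have zw': "z * u = 1" "w * v = 1" using zw by (simp_all add: u_def v_def)
  have "(w * H - b * W * K) * (u * L + e * a * Y * G) +
      e * (w * u * (W * Y)) * (v * K - a * V * H) * (z * G + e * b * Z * L) =
      (1 - a * b) * (w * u * H * L + e * (W * Y) * K * G)"
    using WV zw' e(1) by algebra
  then have alg: "(w * H - b * W * K) * (u * L + e * a * Y * G) +
      e * (w * u) ^ Suc k * (v * K - a * V * H) * (z * G + e * b * Z * L) =
      (1 - a * b) * (w * u * H * L + e * (w * u) ^ k * K * G)"
    by (simp add: W_def Y_def u_def power_mult_distrib mult_ac)
  have 1: "\<rho> * H' = w * H - b * W * K" "\<rho> * G' = z * G + e * b * Z * L"
    using r0 by (simp_all add: H'_def G'_def W_def Z_def b_def K_def L_def)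
  have 2: "\<rho> * cnj H' = v * K - a * V * H" "\<rho> * cnj G' = u * L + e * a * Y * G"
    using r0 e(2) by (simp_all add: H'_def G'_def V_def Y_def b_def K_def L_def u_def v_def rc)
  have "\<rho> * \<rho> * (H' * cnj G' + e * (w * cnj z) ^ Suc k * cnj H' * G') =
      (\<rho> * H') * (\<rho> * cnj G') + e * (w * u) ^ Suc k * (\<rho> * cnj H') * (\<rho> * G')"
    by (simp only: u_def distrib_left mult_ac)
  also have "\<dots> = \<rho> * \<rho> * (w * cnj z * H * cnj G + e * (w * cnj z) ^ k * cnj H * G)"
    unfolding 1 2 alg r(1) by (simp only: u_def b_def K_def L_def)
  finally have "\<rho> * \<rho> * (H' * cnj G' + e * (w * cnj z) ^ Suc k * cnj H' * G') =
      \<rho> * \<rho> * (w * cnj z * H * cnj G + e * (w * cnj z) ^ k * cnj H * G)" .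
  then show ?thesis using r0 by simp
qed

lemma szego_sol_wronskian:
  assumes a: "\<And>n. cmod (a n) < 1" and z: "cmod z = 1"
  shows "szego_sol a z n * cnj (szego_sol (\<lambda>n. - a n) z n) +
    cnj (szego_sol a z n) * szego_sol (\<lambda>n. - a n) z n = 2"
proof (induction n)
  case (Suc n)
  have z1: "z * cnj z = 1" using norm_one_mult_cnj(1)[OF z] .
  show ?case
    using bilinear_step[OF a[of n] z z, where e = 1 and k = n and H = "szego_sol a z n" and G = "szego_sol (\<lambda>n. - a n) z n"] Suc
    by (simp add: z1)
qed simp

text \<open>The Wronskian 2 is at most twice the product of the two moduli.\<close>

lemma szego_sol_lower_bound:
  assumes "\<And>n. cmod (a n) < 1" "cmod z = 1" "\<And>n. cmod (szego_sol (\<lambda>n. - a n) z n) \<le> C"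
  shows "1 \<le> cmod (szego_sol a z n) * C"
proof -
  let ?F = "szego_sol a z n" and ?G = "szego_sol (\<lambda>n. - a n) z n"
  have "2 = cmod (?F * cnj ?G + cnj ?F * ?G)" unfolding szego_sol_wronskian[OF assms(1,2)] by simp
  also have "\<dots> \<le> cmod (?F * cnj ?G) + cmod (cnj ?F * ?G)" by (rule norm_triangle_ineq)
  also have "\<dots> = 2 * (cmod ?F * cmod ?G)" by (simp add: norm_mult)
  finally have "1 \<le> cmod ?F * cmod ?G" by simp
  also have "\<dots> \<le> cmod ?F * C" using assms(3) by (intro mult_left_mono) auto
  finally show ?thesis .
qed

text \<open>In the basis \<open>F, G\<close> the coefficients of the solution at \<open>w\<close>
  move by O(|w - z| C^2) per step, so a discrete Gronwall argument applies. Two more powers of C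
  come from passing from coefficients to values and from the absolute to the relative error.\<close>

lemma szego_sol_perturbation:
  assumes a: "\<And>n. cmod (a n) < 1" and z: "cmod z = 1" and w: "cmod w = 1"
    and FC: "\<And>n. cmod (szego_sol a z n) \<le> C" and GC: "\<And>n. cmod (szego_sol (\<lambda>n. - a n) z n) \<le> C"
    and n: "4 * C ^ 4 * real n * cmod (w - z) \<le> 1"
  shows "cmod (szego_sol a w n - szego_sol a z n) \<le> cmod (szego_sol a z n) / 2"
proof -
  define F G H where "F = szego_sol a z" and "G = szego_sol (\<lambda>n. - a n) z" and "H = szego_sol a w"
  define t where "t = w * cnj z"
  \<comment> \<open>the coefficients of \<open>H\<close> in the basis of solutions \<open>F, G\<close> at \<open>z\<close>\<close>
  define A B where "A k = (H k * cnj (G k) + t ^ k * cnj (H k) * G k) / 2"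
    and "B k = (H k * cnj (F k) - t ^ k * cnj (H k) * F k) / 2" for k
  define d where "d = cmod (w - z)"
  have FG: "cmod (F k) \<le> C" "cmod (G k) \<le> C" for k using FC GC by (simp_all add: F_def G_def)
  have C1: "1 \<le> C" using FC[of 0] by simp
  have td: "cmod (t - 1) = d"
  proof -
    have "t - 1 = (w - z) * cnj z" using norm_one_mult_cnj(1)[OF z] by (simp add: t_def algebra_simps)
    then show ?thesis by (simp add: norm_mult z d_def)
  qed
  have HAB: "H k = A k * F k + B k * G k" for k
  proof -
    \<comment> \<open>Cramer's rule: the terms with \<open>t ^ k\<close> cancel, and the remaining
      bracket is the Wronskian divided by 2.\<close>
    have "A k * F k + B k * G k = H k * ((F k * cnj (G k) + cnj (F k) * G k) / 2)"
      by (simp add: A_def B_def field_simps)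
    then show ?thesis using szego_sol_wronskian[where a = a and n = k, OF a z] by (simp add: F_def G_def)
  qed
  have "H (Suc k) * cnj (G (Suc k)) + t ^ Suc k * cnj (H (Suc k)) * G (Suc k) =
      t * H k * cnj (G k) + t ^ k * cnj (H k) * G k" for k
    using bilinear_step[OF a[of k] z w, where e = 1 and k = k and H = "H k" and G = "G k"]
    by (simp add: t_def H_def G_def)
  then have A_Suc: "A (Suc k) - A k = (t - 1) * H k * cnj (G k) / 2" for k
    unfolding A_def by (simp only:) (simp add: algebra_simps flip: diff_divide_distrib)
  \<comment> \<open>The sign \<open>e = - 1\<close> appears because \<open>F\<close>, unlike
    \<open>G\<close>, has the same coefficients as \<open>H\<close>.\<close>
  have "H (Suc k) * cnj (F (Suc k)) - t ^ Suc k * cnj (H (Suc k)) * F (Suc k) =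
      t * H k * cnj (F k) - t ^ k * cnj (H k) * F k" for k
    using bilinear_step[OF a[of k] z w, where e = "- 1" and k = k and H = "H k" and G = "F k"]
    by (simp add: t_def H_def F_def)
  then have B_Suc: "B (Suc k) - B k = (t - 1) * H k * cnj (F k) / 2" for k
    unfolding B_def by (simp only:) (simp add: algebra_simps flip: diff_divide_distrib)
  define s where "s k = cmod (A k - 1) + cmod (B k)" for k
  have s_step: "s (Suc k) \<le> s k + d * C\<^sup>2 * (1 + s k)" for k
  proof -
    have "cmod (A k) \<le> 1 + cmod (A k - 1)" using norm_triangle_ineq[of 1 "A k - 1"] by simp
    then have AB: "cmod (A k) + cmod (B k) \<le> 1 + s k" by (simp add: s_def)
    have "cmod (H k) \<le> cmod (A k) * cmod (F k) + cmod (B k) * cmod (G k)"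
      unfolding HAB[of k] by (rule norm_triangle_le) (simp add: norm_mult)
    also have "\<dots> \<le> cmod (A k) * C + cmod (B k) * C"
      by (intro add_mono mult_left_mono FG) auto
    also have "\<dots> \<le> C * (1 + s k)"
      using mult_left_mono[OF AB, of C] C1 by (simp add: algebra_simps)
    finally have Hk: "cmod (H k) \<le> C * (1 + s k)" .
    have inc: "cmod ((t - 1) * H k * cnj x / 2) \<le> d * C\<^sup>2 * (1 + s k) / 2" if "cmod x \<le> C" for x
    proof -
      have "cmod (H k) * cmod x \<le> (C * (1 + s k)) * C"
        using Hk that C1 by (intro mult_mono) (auto simp: s_def)
      then have "d * (cmod (H k) * cmod x) \<le> d * ((C * (1 + s k)) * C)"
        by (intro mult_left_mono) (auto simp: d_def)
      moreover have "cmod ((t - 1) * H k * cnj x / 2) = d * (cmod (H k) * cmod x) / 2"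
        by (simp add: norm_mult td norm_divide)
      ultimately show ?thesis by (simp add: power2_eq_square mult_ac)
    qed
    have "cmod (A (Suc k) - 1) \<le> cmod (A (Suc k) - A k) + cmod (A k - 1)"
      using norm_triangle_ineq[of "A (Suc k) - A k" "A k - 1"] by simp
    moreover have "cmod (A (Suc k) - A k) \<le> d * C\<^sup>2 * (1 + s k) / 2"
      unfolding A_Suc by (rule inc[OF FG(2)])
    moreover have "cmod (B (Suc k)) \<le> cmod (B (Suc k) - B k) + cmod (B k)"
      using norm_triangle_ineq[of "B (Suc k) - B k" "B k"] by simp
    moreover have "cmod (B (Suc k) - B k) \<le> d * C\<^sup>2 * (1 + s k) / 2"
      unfolding B_Suc by (rule inc[OF FG(1)])
    ultimately show ?thesis unfolding s_def by linarith
  qed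
  have d0: "0 \<le> d * C\<^sup>2" by (simp add: d_def)
  have s_le: "1 + s k \<le> (1 + d * C\<^sup>2) ^ k" for k
  proof (induction k)
    case 0
    show ?case by (simp add: s_def A_def B_def H_def F_def G_def)
  next
    case (Suc k)
    have "1 + s (Suc k) \<le> (1 + d * C\<^sup>2) * (1 + s k)"
      using s_step[of k] by (simp add: algebra_simps)
    also have "\<dots> \<le> (1 + d * C\<^sup>2) * (1 + d * C\<^sup>2) ^ k"
      using Suc d0 by (intro mult_left_mono) auto
    finally show ?case by simp
  qed
  define x where "x = real n * (d * C\<^sup>2)"
  have x0: "0 \<le> x" using d0 by (simp add: x_def)
  have x4: "4 * (x * C\<^sup>2) \<le> 1" using n by (simp add: x_def d_def power2_eq_square eval_nat_numeral mult_ac)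
  have "x * 1 \<le> x * C\<^sup>2" using C1 x0 by (intro mult_left_mono) auto
  then have x1: "x \<le> 1" using x4 x0 by linarith
  have "(1 + d * C\<^sup>2) ^ n \<le> exp (d * C\<^sup>2) ^ n"
    using d0 by (intro power_mono) auto
  also have "\<dots> = exp x" by (simp add: x_def exp_of_nat_mult)
  also have "\<dots> \<le> 1 + x + x\<^sup>2" by (rule exp_bound[OF x0 x1])
  also have "x\<^sup>2 \<le> x" using x0 x1 by (simp add: power2_eq_square mult_left_le)
  finally have sn: "s n \<le> 2 * x" using s_le[of n] by linarith
  have "H n - F n = (A n - 1) * F n + B n * G n" using HAB[of n] by (simp add: algebra_simps)
  then have "cmod (H n - F n) \<le> cmod (A n - 1) * cmod (F n) + cmod (B n) * cmod (G n)"
    using norm_triangle_ineq[of "(A n - 1) * F n" "B n * G n"] by (simp add: norm_mult)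
  also have "\<dots> \<le> cmod (A n - 1) * C + cmod (B n) * C" by (intro add_mono mult_left_mono FG) auto
  also have "\<dots> = s n * C" by (simp add: s_def algebra_simps)
  also have "\<dots> \<le> 2 * x * C" using sn C1 by (intro mult_right_mono) auto
  \<comment> \<open>The inserted factor is at least 1 by the Wronskian bound; it makes the error
    relative to |F n|.\<close>
  also have "\<dots> \<le> 2 * x * C * (cmod (F n) * C)"
    using mult_left_mono[OF szego_sol_lower_bound[OF a z GC, of n], of "2 * x * C"] x0 C1
    by (simp add: F_def)
  also have "\<dots> = (4 * (x * C\<^sup>2)) * (cmod (F n) / 2)" by (simp add: power2_eq_square)
  also have "\<dots> \<le> 1 * (cmod (F n) / 2)" using x4 by (intro mult_right_mono) auto
  finally show ?thesis by (simp add: F_def H_def)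
qed

section \<open>Boundedness in an arbitrary matrix norm\<close>

text \<open>Expansion in the four matrix units; \<open>K\<close> is the sum of their norms.\<close>

lemma is_matrix_norm_bound:
  assumes "is_matrix_norm N"
  shows "\<exists>K. \<forall>A B. (\<forall>i j. cmod (A $ i $ j) \<le> B) \<longrightarrow> N A \<le> K * B"
proof -
  define E :: "2 \<Rightarrow> 2 \<Rightarrow> complex^2^2" where "E k l = (\<chi> i j. if i = k \<and> j = l then 1 else 0)" for k l
  have N: "0 \<le> N A" "N (\<chi> i j. c * A $ i $ j) = cmod c * N A" "N (A + B) \<le> N A + N B" for A B c
    using assms by (auto simp: is_matrix_norm_def)
  define T where "T A k l = (\<chi> i j. (A $ k $ l) * E k l $ i $ j)" for A :: "complex^2^2" and k l
  have dec: "A = (T A 1 1 + T A 1 2) + (T A 2 1 + T A 2 2)" for A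
    by (simp add: vec_eq_iff T_def E_def forall_2)
  define K where "K = (N (E 1 1) + N (E 1 2)) + (N (E 2 1) + N (E 2 2))"
  have "N A \<le> K * B" if "\<And>i j. cmod (A $ i $ j) \<le> B" for A B
  proof -
    have t: "N (T A k l) \<le> B * N (E k l)" for k l
      unfolding T_def N(2) using that N(1) by (intro mult_right_mono)
    have "N A \<le> (N (T A 1 1) + N (T A 1 2)) + (N (T A 2 1) + N (T A 2 2))"
      by (subst dec) (meson N(3) add_mono order_trans)
    also have "\<dots> \<le> K * B"
      using t[of 1 1] t[of 1 2] t[of 2 1] t[of 2 2] by (simp add: K_def algebra_simps)
    finally show ?thesis .
  qed
  then show ?thesis by blast
qed

context circle_measure
begin

lemma szego_matrix_bounded:
  assumes N: "is_matrix_norm N" and z: "cmod z = 1"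
    and b: "bounded_sol (verblunsky \<mu>) z" "bounded_sol (\<lambda>n. - verblunsky \<mu> n) z"
  shows "bdd_above (range (\<lambda>n. N (szego_matrix \<mu> n z)))"
proof -
  obtain C D where C: "\<And>n. cmod (poly (orthonormal_op \<mu> n) z) \<le> C"
    and D: "\<And>n. cmod (poly (second_kind (verblunsky \<mu>) n) z) \<le> D"
    using b by (auto simp: bounded_sol_def poly_orthonormal_op_circle[OF z] poly_second_kind_circle[OF z])
  obtain K where K: "\<And>A B. (\<forall>i j. cmod (A $ i $ j) \<le> B) \<Longrightarrow> N A \<le> K * B"
    using is_matrix_norm_bound[OF N] by blast
  have dual: "cmod (poly (szego_dual P) z) = cmod (poly P z)" for P
    by (simp add: poly_szego_dual_circle[OF z] norm_mult norm_power z)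
  have "N (szego_matrix \<mu> n z) \<le> K * (C + D)" for n
  proof (rule K, intro allI)
    fix i j :: 2
    have tri: "cmod (x + y) \<le> C * 2 + D * 2" "cmod (x - y) \<le> C * 2 + D * 2"
      if "cmod x \<le> C" "cmod y \<le> D" for x y
      using norm_triangle_ineq[of x y] norm_triangle_ineq4[of x y] that
        norm_ge_zero[of x] norm_ge_zero[of y] by linarith+
    show "cmod (szego_matrix \<mu> n z $ i $ j) \<le> C + D"
      using exhaust_2[of i] exhaust_2[of j] C[of n] D[of n]
      by (auto simp: szego_matrix_def Let_def dual intro!: tri)
  qed
  then show ?thesis by (intro bdd_aboveI) auto
qed

text \<open>The test polynomial is the Christoffel--Darboux kernel with one argument frozen at \<open>z\<close>.\<close>

lemma measure_cball_le_Christoffel: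
  assumes z: "cmod z = 1"
    and FC: "\<And>n. cmod (szego_sol (verblunsky \<mu>) z n) \<le> C"
    and GC: "\<And>n. cmod (szego_sol (\<lambda>n. - verblunsky \<mu> n) z n) \<le> C"
    and n: "0 < n" "4 * C ^ 4 * real n * \<delta> \<le> 1"
  shows "measure \<mu> (cball z \<delta> \<inter> unit_circle) \<le> 4 * C\<^sup>2 / real n"
proof -
  let ?\<phi> = "orthonormal_op \<mu>"
  define F where "F k = poly (?\<phi> k) z" for k
  define Q where "Q = (\<Sum>k<n. smult (cnj (F k)) (?\<phi> k))"
  define K where "K = (\<Sum>k<n. (cmod (F k))\<^sup>2)"
  note a = norm_verblunsky_less_1
  have F: "F k = szego_sol (verblunsky \<mu>) z k" for k
    by (simp add: F_def poly_orthonormal_op_circle[OF z])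
  have C1: "1 \<le> C" using FC[of 0] by simp
  \<comment> \<open>Each term of \<open>K\<close> is at least 1 / C^2 by the Wronskian
    bound.\<close>
  have Kn: "real n \<le> K * C\<^sup>2"
  proof -
    have "1 \<le> (cmod (F k))\<^sup>2 * C\<^sup>2" for k
      using szego_sol_lower_bound[OF a z GC, of k] by (simp add: F flip: power_mult_distrib)
    then have "real (card {..<n}) * 1 \<le> (\<Sum>k<n. (cmod (F k))\<^sup>2 * C\<^sup>2)" by (intro sum_bounded_below)
    then show ?thesis by (simp add: K_def sum_distrib_right)
  qed
  have "0 < K * C\<^sup>2" using Kn n(1) by linarith
  then have K0: "0 < K" by (simp add: zero_less_mult_iff)
  have "ip (smult (cnj (F j)) (?\<phi> j)) Q = F j * cnj (F j)" if "j < n" for j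
    unfolding Q_def ip_sum_right using that
    by (simp add: ip_smult_left ip_smult_right orthonormal_op_orthonormal if_distrib cong: if_cong)
  moreover have "ip Q Q = (\<Sum>j<n. ip (smult (cnj (F j)) (?\<phi> j)) Q)"
    by (subst (1) Q_def) (rule ip_sum_left)
  ultimately have "ip Q Q = (\<Sum>j<n. F j * cnj (F j))" by simp
  also have "\<dots> = of_real K" by (simp only: K_def of_real_sum complex_norm_square)
  finally have QQ: "(\<integral>w. (cmod (poly Q w))\<^sup>2 \<partial>\<mu>) = K" by (simp add: ip_self)
  \<comment> \<open>Near \<open>z\<close> every summand of the kernel differs from its value at
    \<open>z\<close> by at most half of it, and those values are positive, so no cancellation
    occurs.\<close>
  have low: "K / 2 \<le> cmod (poly Q w)" if w: "w \<in> cball z \<delta>" "cmod w = 1" for w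
  proof -
    have dw: "cmod (w - z) \<le> \<delta>" using w(1) by (simp add: dist_norm norm_minus_commute)
    have "cmod (poly Q w - of_real K) = cmod (\<Sum>k<n. cnj (F k) * (poly (?\<phi> k) w - F k))"
      by (simp add: Q_def K_def poly_sum right_diff_distrib sum_subtractf mult.commute complex_norm_square del: of_real_power)
    also have "\<dots> \<le> (\<Sum>k<n. (cmod (F k))\<^sup>2 / 2)"
    proof (rule sum_norm_le)
      fix k assume k: "k \<in> {..<n}"
      have "4 * C ^ 4 * real k * cmod (w - z) \<le> 4 * C ^ 4 * real n * \<delta>"
        using k dw C1 by (intro mult_mono) auto
      then have "cmod (poly (?\<phi> k) w - F k) \<le> cmod (F k) / 2"
        unfolding F poly_orthonormal_op_circle[OF w(2)]
        by (intro szego_sol_perturbation[OF a z w(2) FC GC]) (use n(2) in linarith)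
      then have "cmod (F k) * cmod (poly (?\<phi> k) w - F k) \<le> cmod (F k) * (cmod (F k) / 2)"
        by (intro mult_left_mono) auto
      then show "cmod (cnj (F k) * (poly (?\<phi> k) w - F k)) \<le> (cmod (F k))\<^sup>2 / 2"
        by (simp add: norm_mult power2_eq_square)
    qed
    also have "\<dots> = K / 2" by (simp add: K_def sum_divide_distrib)
    finally have "cmod (poly Q w - of_real K) \<le> K / 2" .
    moreover have "cmod (of_real K) \<le> cmod (poly Q w) + cmod (of_real K - poly Q w)"
      using norm_triangle_ineq[of "poly Q w" "of_real K - poly Q w"] by simp
    ultimately show ?thesis using K0 by (simp add: norm_minus_commute)
  qed
  define B where "B = cball z \<delta> \<inter> unit_circle"
  have Bs: "B \<in> sets \<mu>" unfolding B_def sets_mu by (auto simp: sets_restrict_space Int_commute)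
  \<comment> \<open>Chebyshev's inequality: the squared norm of \<open>Q\<close> is only
    \<open>K\<close>, while |Q| >= K / 2 on the ball, so the ball has measure at most 4 / K.\<close>
  have "(K / 2)\<^sup>2 * measure \<mu> B = (\<integral>w. (K / 2)\<^sup>2 * indicator B w \<partial>\<mu>)"
    using Bs by (simp add: integral_mult_right_zero)
  also have "\<dots> \<le> (\<integral>w. (cmod (poly Q w))\<^sup>2 \<partial>\<mu>)"
  proof (rule integral_mono)
    show "integrable \<mu> (\<lambda>w. (K / 2)\<^sup>2 * indicator B w)"
      using Bs by (intro integrable_mult_right integrable_real_indicator) (auto simp: emeasure_eq_measure)
    show "integrable \<mu> (\<lambda>w. (cmod (poly Q w))\<^sup>2)" by (intro integrable_continuous continuous_intros)
    fix w assume "w \<in> space \<mu>"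
    show "(K / 2)\<^sup>2 * indicator B w \<le> (cmod (poly Q w))\<^sup>2"
    proof (cases "w \<in> B")
      case True
      then have "(K / 2)\<^sup>2 \<le> (cmod (poly Q w))\<^sup>2"
        using low[of w] K0 by (intro power_mono) (auto simp: B_def)
      then show ?thesis using True by simp
    qed simp
  qed
  also have "\<dots> = K" by (rule QQ)
  finally have "K * (K * measure \<mu> B) \<le> K * 4" by (simp add: power2_eq_square)
  then have KB: "K * measure \<mu> B \<le> 4" using K0 by (simp add: mult_le_cancel_left)
  have "real n * measure \<mu> B \<le> (K * C\<^sup>2) * measure \<mu> B" using Kn by (intro mult_right_mono) auto
  also have "\<dots> \<le> 4 * C\<^sup>2" using mult_right_mono[OF KB, of "C\<^sup>2"] by (simp add: mult_ac)
  finally show ?thesis using n(1) by (simp add: B_def pos_le_divide_eq mult.commute)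
qed

text \<open>The largest n allowed by the Christoffel bound is the floor of 1/y with y = 4 C^4
  \<delta>. As y <= 1, it is at least 1/(2y), and 4 C^2 * 2y gives the constant 32 C^6.\<close>

lemma measure_cball_le:
  assumes z: "cmod z = 1"
    and FC: "\<And>n. cmod (szego_sol (verblunsky \<mu>) z n) \<le> C"
    and GC: "\<And>n. cmod (szego_sol (\<lambda>n. - verblunsky \<mu> n) z n) \<le> C"
    and \<delta>: "0 < \<delta>" "4 * C ^ 4 * \<delta> \<le> 1"
  shows "measure \<mu> (cball z \<delta> \<inter> unit_circle) \<le> 32 * C ^ 6 * \<delta>"
proof -
  have C1: "1 \<le> C" using FC[of 0] by simp
  define y where "y = 4 * C ^ 4 * \<delta>"
  have y: "0 < y" "y \<le> 1" using C1 \<delta> by (simp_all add: y_def)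
  define n where "n = nat \<lfloor>1 / y\<rfloor>"
  have "1 \<le> 1 / y" using y by simp
  then have n: "real n \<le> 1 / y" "1 / y < real n + 1" "0 < n" by (simp_all add: n_def of_nat_nat) linarith+
  have "1 / y \<le> 2 * real n" using n by linarith
  then have 2: "1 \<le> 2 * real n * y" using y by (simp add: pos_divide_le_eq)
  have "real n * y \<le> 1" using n(1) y by (simp add: pos_le_divide_eq)
  then have "measure \<mu> (cball z \<delta> \<inter> unit_circle) \<le> 4 * C\<^sup>2 / real n"
    by (intro measure_cball_le_Christoffel[OF z FC GC n(3)]) (simp add: y_def mult_ac)
  also have "\<dots> \<le> 4 * C\<^sup>2 * (2 * real n * y) / real n"
    using 2 mult_left_mono[OF 2, of "4 * C\<^sup>2"] by (intro divide_right_mono) auto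
  also have "\<dots> = 32 * C ^ 6 * \<delta>" using n(3) by (simp add: y_def eval_nat_numeral)
  finally show ?thesis .
qed

end

section \<open>The singular part\<close>

text \<open>The carrier \<open>N\<close> of the singular part is an \<open>m\<close>-null set of maximal \<open>\<mu>\<close>-measure.\<close>

lemma lebesgue_decomposition:
  fixes m \<mu> :: "'a measure"
  assumes fin: "finite_measure \<mu>" and sets_eq: "sets m = sets \<mu>"
  shows "\<exists>N\<in>null_sets m. singular_part m \<mu> = density \<mu> (indicator N)"
proof -
  interpret finite_measure \<mu> by fact
  have space_eq: "space m = space \<mu>" by (rule sets_eq_imp_space_eq[OF sets_eq])
  define s where "s = Sup (emeasure \<mu> ` null_sets m)"
  obtain f :: "nat \<Rightarrow> ennreal" where f: "range f \<subseteq> emeasure \<mu> ` null_sets m" "s = (SUP i. f i)"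
    using ennreal_Sup_countable_SUP[of "emeasure \<mu> ` null_sets m"] unfolding s_def by auto
  then have "\<forall>i. \<exists>E. E \<in> null_sets m \<and> f i = emeasure \<mu> E" by auto
  then obtain E where E: "\<And>i. E i \<in> null_sets m" "\<And>i. f i = emeasure \<mu> (E i)" by metis
  define N where "N = (\<Union>i. E i)"
  have N: "N \<in> null_sets m" unfolding N_def using E(1) by (rule null_sets_UN)
  then have Ns: "N \<in> sets \<mu>" using sets_eq by (auto simp: null_sets_def)
  have Es: "E i \<in> sets \<mu>" for i using E(1)[of i] sets_eq by (auto simp: null_sets_def)
  \<comment> \<open>The union of a maximising sequence is still null and attains the
    supremum.\<close>
  have sN: "s \<le> emeasure \<mu> N" unfolding f(2)
  proof (rule SUP_least)
    fix i show "f i \<le> emeasure \<mu> N"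
      unfolding E(2) using Ns by (intro emeasure_mono) (auto simp: N_def)
  qed
  \<comment> \<open>Adjoining \<open>B\<close> to \<open>N\<close> gives another null set, which
    cannot exceed the supremum; cancelling the mass of \<open>N\<close> uses that
    \<open>\<mu>\<close> is finite.\<close>
  have maximal: "emeasure \<mu> (B - N) = 0" if B: "B \<in> null_sets m" for B
  proof -
    have Bs: "B \<in> sets \<mu>" using B sets_eq by (auto simp: null_sets_def)
    have "emeasure \<mu> (N \<union> (B - N)) = emeasure \<mu> N + emeasure \<mu> (B - N)"
      using Ns Bs by (intro plus_emeasure[symmetric]) auto
    moreover have "N \<union> (B - N) \<in> null_sets m" using N B by (auto intro: null_sets.Un simp: Un_Diff_cancel)
    then have "emeasure \<mu> (N \<union> (B - N)) \<le> s" unfolding s_def by (rule SUP_upper)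
    ultimately have "emeasure \<mu> N + emeasure \<mu> (B - N) \<le> emeasure \<mu> N"
      using sN by (metis order_trans)
    then have "measure \<mu> N + measure \<mu> (B - N) \<le> measure \<mu> N"
      by (simp add: emeasure_eq_measure flip: ennreal_plus)
    then show ?thesis using measure_nonneg[of \<mu> "B - N"] by (simp add: emeasure_eq_measure)
  qed
  define \<sigma> \<tau> where "\<sigma> = density \<mu> (indicator N)" and "\<tau> = density \<mu> (indicator (space \<mu> - N))"
  have em_\<sigma>: "emeasure \<sigma> B = emeasure \<mu> (N \<inter> B)" if "B \<in> sets \<mu>" for B
    unfolding \<sigma>_def using Ns that by (rule emeasure_restricted)
  have em_\<tau>: "emeasure \<tau> B = emeasure \<mu> (B - N)" if "B \<in> sets \<mu>" for B
  proof -
    have "emeasure \<tau> B = emeasure \<mu> ((space \<mu> - N) \<inter> B)"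
      unfolding \<tau>_def using Ns that by (intro emeasure_restricted) auto
    also have "(space \<mu> - N) \<inter> B = B - N" using sets.sets_into_space[OF that] by auto
    finally show ?thesis .
  qed
  have "singular_part m \<mu> = \<sigma>"
    unfolding singular_part_def
  proof (rule the_equality)
    have "mutually_singular \<sigma> m"
      unfolding mutually_singular_def
    proof (intro bexI conjI)
      show "emeasure m N = 0" using N by auto
      have "N \<inter> (space \<mu> - N) = {}" by auto
      then show "emeasure \<sigma> (space \<sigma> - N) = 0" using Ns by (simp add: em_\<sigma>) (simp add: \<sigma>_def em_\<sigma>[unfolded \<sigma>_def])
      show "N \<in> sets \<sigma> \<inter> sets m" using Ns sets_eq by (simp add: \<sigma>_def)
    qed
    moreover have "absolutely_continuous m \<tau>"
      unfolding absolutely_continuous_def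
    proof
      fix B assume B: "B \<in> null_sets m"
      then have "B \<in> sets \<mu>" using sets_eq by (auto simp: null_sets_def)
      then show "B \<in> null_sets \<tau>" using maximal[OF B] em_\<tau>[of B] by (auto simp: null_sets_def \<tau>_def)
    qed
    moreover have "emeasure \<mu> A = emeasure \<tau> A + emeasure \<sigma> A" if "A \<in> sets \<mu>" for A
    proof -
      have "emeasure \<mu> A = emeasure \<mu> ((A - N) \<union> (N \<inter> A))" by (rule arg_cong[where f = "emeasure \<mu>"]) auto
      also have "\<dots> = emeasure \<mu> (A - N) + emeasure \<mu> (N \<inter> A)"
        using that Ns by (intro plus_emeasure[symmetric]) auto
      finally show ?thesis using that by (simp add: em_\<sigma> em_\<tau>)
    qed
    moreover have "sets \<sigma> = sets \<mu>" "sets \<tau> = sets \<mu>" by (simp_all add: \<sigma>_def \<tau>_def)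
    ultimately show "sets \<sigma> = sets \<mu> \<and> mutually_singular \<sigma> m \<and>
      (\<exists>\<tau>. sets \<tau> = sets \<mu> \<and> absolutely_continuous m \<tau> \<and>
        (\<forall>A \<in> sets \<mu>. emeasure \<mu> A = emeasure \<tau> A + emeasure \<sigma> A))" by blast
  next
    fix \<sigma>' assume "sets \<sigma>' = sets \<mu> \<and> mutually_singular \<sigma>' m \<and>
      (\<exists>\<tau>. sets \<tau> = sets \<mu> \<and> absolutely_continuous m \<tau> \<and>
        (\<forall>A \<in> sets \<mu>. emeasure \<mu> A = emeasure \<tau> A + emeasure \<sigma>' A))"
    then obtain A \<tau>' where \<sigma>': "sets \<sigma>' = sets \<mu>"
      and A: "A \<in> sets \<mu>" "emeasure \<sigma>' (space \<sigma>' - A) = 0" "emeasure m A = 0"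
      and \<tau>': "sets \<tau>' = sets \<mu>" "absolutely_continuous m \<tau>'"
      and dec: "\<And>B. B \<in> sets \<mu> \<Longrightarrow> emeasure \<mu> B = emeasure \<tau>' B + emeasure \<sigma>' B"
      using sets_eq by (auto simp: mutually_singular_def)
    have An: "A \<in> null_sets m" using A sets_eq by (auto simp: null_sets_def)
    show "\<sigma>' = \<sigma>"
    proof (rule measure_eqI)
      show "sets \<sigma>' = sets \<sigma>" by (simp add: \<sigma>' \<sigma>_def)
      fix B assume "B \<in> sets \<sigma>'"
      then have B: "B \<in> sets \<mu>" by (simp add: \<sigma>')
      \<comment> \<open>\<open>N \<union> A\<close> carries both candidates and is null, so the
        other absolutely continuous part vanishes on \<open>D\<close>. There
        \<open>\<sigma>'\<close> equals \<open>\<mu>\<close>, and by maximality only the part inside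
        \<open>N\<close> counts.\<close>
      define D where "D = B \<inter> (N \<union> A)"
      have Dn: "D \<in> null_sets m" unfolding D_def Int_commute[of B]
        using N An B sets_eq by (intro null_set_Int2) (auto intro: null_sets.Un)
      have Ds: "D \<in> sets \<mu>" using B Ns A by (auto simp: D_def)
      have "emeasure \<sigma>' (B - D) \<le> emeasure \<sigma>' (space \<sigma>' - A)"
        using A \<sigma>' B sets.sets_into_space[OF B] sets_eq_imp_space_eq[OF \<sigma>']
        by (intro emeasure_mono) (auto simp: D_def)
      then have "emeasure \<sigma>' (B - D) = 0" using A by simp
      moreover have "emeasure \<sigma>' (D \<union> (B - D)) = emeasure \<sigma>' D + emeasure \<sigma>' (B - D)"
        using Ds B \<sigma>' by (intro plus_emeasure[symmetric]) auto
      moreover have "D \<union> (B - D) = B" by (auto simp: D_def)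
      ultimately have "emeasure \<sigma>' B = emeasure \<sigma>' D" by simp
      also have "\<dots> = emeasure \<mu> D"
      proof -
        have "D \<in> null_sets \<tau>'" using \<tau>'(2) Dn by (auto simp: absolutely_continuous_def)
        then show ?thesis using dec[OF Ds] by auto
      qed
      also have "\<dots> = emeasure \<mu> ((N \<inter> B) \<union> (D - N))"
        by (rule arg_cong[where f = "emeasure \<mu>"]) (auto simp: D_def)
      also have "\<dots> = emeasure \<mu> (N \<inter> B) + emeasure \<mu> (D - N)"
        using Ns B Ds by (intro plus_emeasure[symmetric]) auto
      also have "\<dots> = emeasure \<sigma> B" using maximal[OF Dn] by (simp add: em_\<sigma>[OF B])
      finally show "emeasure \<sigma>' B = emeasure \<sigma> B" .
    qed
  qed
  then show ?thesis using N unfolding \<sigma>_def by blast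
qed

text \<open>The singular part is \<open>\<mu>\<close> restricted to a null set \<open>N\<close>, so
  its mass on \<open>A\<close> is that of the null subset \<open>N \<inter> A\<close> under
  \<open>\<mu>\<close>.\<close>

lemma singular_part_supported_by:
  fixes m \<mu> :: "'a measure"
  assumes fin: "finite_measure \<mu>" and sets_eq: "sets m = sets \<mu>" and A: "A \<in> sets \<mu>"
    and ac: "\<And>E. E \<in> null_sets m \<Longrightarrow> E \<subseteq> A \<Longrightarrow> emeasure \<mu> E = 0"
  shows "supported_by (singular_part m \<mu>) (space \<mu> - A)"
proof -
  obtain N where N: "N \<in> null_sets m" and \<sigma>: "singular_part m \<mu> = density \<mu> (indicator N)"
    using lebesgue_decomposition[OF fin sets_eq] by blast
  have Ns: "N \<in> sets \<mu>" using N sets_eq by (auto simp: null_sets_def)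
  have "N \<inter> A \<in> null_sets m" using N A sets_eq by (intro null_set_Int2) auto
  then have "emeasure \<mu> (N \<inter> A) = 0" by (rule ac) auto
  moreover have "space \<mu> - (space \<mu> - A) = A" using sets.sets_into_space[OF A] by auto
  ultimately show ?thesis
    using A emeasure_restricted[OF Ns A] by (simp add: supported_by_def \<sigma>)
qed

section \<open>Dyadic arcs\<close>

lemma cmod_cis_diff_le: "cmod (cis s - cis t) \<le> \<bar>s - t\<bar>"
proof -
  have "cis s - cis t = cis t * (exp (\<i> * of_real (s - t)) - 1)"
    unfolding cis_conv_exp[symmetric] by (simp add: right_diff_distrib cis_mult)
  then have "cmod (cis s - cis t) = 2 * \<bar>sin ((s - t) / 2)\<bar>"
    by (simp only: norm_mult norm_cis dist_exp_i_1 mult_1)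
  then show ?thesis using abs_sin_x_le_abs_x[of "(s - t) / 2"] by simp
qed

text \<open>Closed intervals have compact images under \<open>cis\<close>, hence measurable arcs;
  the shared endpoints do no harm, since the arcs serve only as a cover.\<close>

definition dyadic :: "nat \<Rightarrow> nat \<Rightarrow> real set" where
  "dyadic m j = {real j / 2 ^ m..(real j + 1) / 2 ^ m}"

lemma dyadic_split: "t \<in> dyadic m j \<Longrightarrow> \<exists>i\<in>{2 * j, 2 * j + 1}. t \<in> dyadic (Suc m) i"
  by (cases "t \<le> (2 * real j + 1) / 2 ^ Suc m") (auto simp: dyadic_def field_simps)

lemma dyadic_subset: "i \<in> {2 * j, 2 * j + 1} \<Longrightarrow> dyadic (Suc m) i \<subseteq> dyadic m j"
  by (auto simp: dyadic_def field_simps)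

text \<open>Dropping right endpoints makes the intervals disjoint without changing their
  lengths.\<close>

lemma card_dyadic_le:
  assumes "open U" "emeasure lborel U \<le> ennreal e" "0 \<le> e" "finite J" "\<And>j. j \<in> J \<Longrightarrow> dyadic m j \<subseteq> U"
  shows "real (card J) * (1 / 2 ^ m) \<le> e"
proof -
  define I where "I j = {real j / 2 ^ m..<(real j + 1) / 2 ^ m}" for j
  have disj: "disjoint_family_on I J"
    unfolding disjoint_family_on_def
  proof (intro ballI impI)
    fix i j :: nat assume "i \<noteq> j"
    then have "real i + 1 \<le> real j \<or> real j + 1 \<le> real i" by linarith
    then have "(real i + 1) / 2 ^ m \<le> real j / 2 ^ m \<or> (real j + 1) / 2 ^ m \<le> real i / 2 ^ m"
      by (auto intro: divide_right_mono)
    then show "I i \<inter> I j = {}" by (auto simp: I_def)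
  qed
  have len: "emeasure lborel (I j) = ennreal (1 / 2 ^ m)" for j
  proof -
    have "real j / 2 ^ m \<le> (real j + 1) / 2 ^ m" by (intro divide_right_mono) auto
    then have "emeasure lborel (I j) = ennreal ((real j + 1) / 2 ^ m - real j / 2 ^ m)"
      by (simp add: I_def)
    then show ?thesis by (simp add: add_divide_distrib)
  qed
  have "ennreal (real (card J) * (1 / 2 ^ m)) = (\<Sum>j\<in>J. emeasure lborel (I j))"
    by (simp add: len ennreal_mult ennreal_of_nat_eq_real_of_nat flip: ennreal_mult')
  also have "\<dots> = emeasure lborel (\<Union>j\<in>J. I j)"
    by (rule sum_emeasure[OF _ disj assms(4)]) (auto simp: I_def)
  also have "\<dots> \<le> emeasure lborel U"
    using assms(1,5) by (intro emeasure_mono) (fastforce simp: I_def dyadic_def)+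
  also have "\<dots> \<le> ennreal e" by fact
  finally show ?thesis using assms(3) by (simp add: ennreal_le_iff)
qed

context circle_measure
begin

lemma sets_circle_lebesgue: "sets circle_lebesgue = sets \<mu>"
  by (simp add: circle_lebesgue_def sets_mu)

lemma cis_measurable_circle:
  "cis \<in> measurable (restrict_space lborel {0..<2 * pi}) (restrict_space borel unit_circle)"
proof (rule measurable_restrict_space2)
  have "cis \<in> borel_measurable borel"
    by (intro borel_measurable_continuous_onI continuous_intros)
  then show "cis \<in> borel_measurable (restrict_space lborel {0..<2 * pi})"
    by (intro measurable_restrict_space1) simp
qed simp

definition good_set :: "real \<Rightarrow> complex set" where
  "good_set C = {z. cmod z = 1 \<and> (\<forall>n. cmod (szego_sol (verblunsky \<mu>) z n) \<le> C \<and>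
     cmod (szego_sol (\<lambda>n. - verblunsky \<mu> n) z n) \<le> C)}"

text \<open>Rewritten with polynomials, the defining conditions are closed by continuity.\<close>

lemma good_set_sets: "good_set C \<in> sets \<mu>"
proof -
  have eq: "good_set C = {z. cmod z = 1 \<and> (\<forall>n. cmod (poly (orthonormal_op \<mu> n) z) \<le> C \<and>
     cmod (poly (second_kind (verblunsky \<mu>) n) z) \<le> C)}"
    by (auto simp: good_set_def poly_orthonormal_op_circle poly_second_kind_circle)
  have "closed (good_set C)"
    unfolding eq
    by (intro closed_Collect_conj closed_Collect_all closed_Collect_le closed_Collect_eq continuous_intros)
  then show ?thesis
    unfolding sets_mu by (subst sets_restrict_space_iff) (auto simp: good_set_def)
qed

text \<open>On \<open>good_set C\<close> balls have \<open>\<mu>\<close>-measure \<open>O(r)\<close>. Exhausting an open superset of small Lebesgue measure by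
  dyadic arcs needs no covering theorem.\<close>

lemma null_subset_good_set:
  assumes E: "E \<in> null_sets circle_lebesgue" "E \<subseteq> good_set C"
  shows "emeasure \<mu> E = 0"
proof -
  define L where "L = 32 * C ^ 6"
  have Es: "E \<in> sets \<mu>" using E(1) by (auto simp: null_sets_def sets_circle_lebesgue)
  define E' where "E' = cis -` E \<inter> {0..<2 * pi}"
  have E'_sets: "E' \<in> sets lborel"
  proof -
    have "cis -` E \<inter> space (restrict_space lborel {0..<2 * pi}) \<in> sets (restrict_space lborel {0..<2 * pi})"
      using Es by (intro measurable_sets[OF cis_measurable_circle]) (simp add: sets_mu)
    then show ?thesis
      by (subst (asm) sets_restrict_space_iff) (auto simp: E'_def space_restrict_space)
  qed
  have E'0: "emeasure lborel E' = 0"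
  proof -
    have "emeasure circle_lebesgue E = 0" using E(1) by auto
    then have "emeasure (restrict_space lborel {0..<2 * pi}) E' = 0"
      unfolding circle_lebesgue_def using Es
      by (subst (asm) emeasure_distr[OF cis_measurable_circle])
        (auto simp: sets_mu E'_def space_restrict_space)
    then show ?thesis by (subst (asm) emeasure_restrict_space) (auto simp: E'_def)
  qed
  have bound: "measure \<mu> E \<le> L * e" if e: "0 < e" for e
  proof (cases "E = {}")
    case True
    then show ?thesis using e by (simp add: L_def zero_le_even_power)
  next
    case False
    then obtain z0 where "z0 \<in> good_set C" using E(2) by auto
    then have C1: "1 \<le> C" unfolding good_set_def by (auto dest: spec[of _ 0])
    have L0: "0 \<le> L" using C1 by (simp add: L_def)
    obtain U where U: "open U" "E' \<subseteq> U" "emeasure lborel (U - E') < ennreal e"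
      using outer_regular_lborel[OF _ e, of E'] E'_sets by auto
    have Ue: "emeasure lborel U \<le> ennreal e"
    proof -
      have "emeasure lborel U = emeasure lborel (E' \<union> (U - E'))"
        using U(2) by (intro arg_cong[where f = "emeasure lborel"]) auto
      also have "\<dots> = emeasure lborel E' + emeasure lborel (U - E')"
        using E'_sets U(1) by (intro plus_emeasure[symmetric]) auto
      finally show ?thesis using U(3) E'0 by simp
    qed
    \<comment> \<open>The bound 8 exceeds 2 pi, so every dyadic interval around a parameter in [0, 2
      pi) that fits into \<open>U\<close> is listed, and the list stays finite.\<close>
    define J where "J m = {j. j < 8 * 2 ^ m \<and> dyadic m j \<subseteq> U}" for m
    define W where "W m = (\<Union>j\<in>J m. E \<inter> cis ` dyadic m j)" for m
    have J: "finite (J m)" for m by (simp add: J_def)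
    have arc_sets: "E \<inter> cis ` dyadic m j \<in> sets \<mu>" for m j
    proof -
      have "compact (cis ` dyadic m j)"
        by (intro compact_continuous_image continuous_intros) (simp add: dyadic_def)
      then have "cis ` dyadic m j \<in> sets \<mu>"
        unfolding sets_mu by (subst sets_restrict_space_iff) (auto intro: compact_imp_closed borel_closed)
      then show ?thesis using Es by auto
    qed
    have W_sets: "W m \<in> sets \<mu>" for m unfolding W_def using J arc_sets by (rule sets.finite_UN)
    have inc: "incseq W"
    proof (rule incseq_SucI, rule subsetI)
      fix m z assume "z \<in> W m"
      then obtain j t where j: "j \<in> J m" "t \<in> dyadic m j" "z = cis t" "z \<in> E" by (auto simp: W_def)
      obtain i where i: "i \<in> {2 * j, 2 * j + 1}" "t \<in> dyadic (Suc m) i"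
        using dyadic_split[OF j(2)] by blast
      have "i \<in> J (Suc m)" using i(1) j(1) dyadic_subset[OF i(1), of m] by (auto simp: J_def)
      then show "z \<in> W (Suc m)" using i(2) j(3,4) by (auto simp: W_def)
    qed
    have UN: "(\<Union>m. W m) = E"
    proof
      show "(\<Union>m. W m) \<subseteq> E" by (auto simp: W_def)
      show "E \<subseteq> (\<Union>m. W m)"
      proof
        fix z assume z: "z \<in> E"
        then have "cmod z = 1" using E(2) by (auto simp: good_set_def)
        then have "\<exists>t. 0 \<le> t \<and> t < 2 * pi \<and> z = cis t"
          using Arg2pi[of z] Arg2pi_eq[of z] by (intro exI[of _ "Arg2pi z"]) (simp add: cis_conv_exp)
        then obtain t where t: "0 \<le> t" "t < 2 * pi" "z = cis t" by blast
        then have "t \<in> U" using U(2) z by (auto simp: E'_def)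
        then obtain r where r: "0 < r" "ball t r \<subseteq> U" using U(1) open_contains_ball by blast
        obtain m where m: "(1 / 2) ^ m < r" using real_arch_pow_inv[OF r(1), of "1/2"] by auto
        define j where "j = nat \<lfloor>t * 2 ^ m\<rfloor>"
        have j: "real j \<le> t * 2 ^ m" "t * 2 ^ m < real j + 1" using t(1) by (simp_all add: j_def)
        then have tj: "t \<in> dyadic m j" by (simp add: dyadic_def field_simps)
        have "dyadic m j \<subseteq> ball t r"
        proof
          fix x assume "x \<in> dyadic m j"
          then have "\<bar>t - x\<bar> \<le> (real j + 1) / 2 ^ m - real j / 2 ^ m"
            using tj unfolding dyadic_def by auto
          then show "x \<in> ball t r" using m by (simp add: dist_real_def add_divide_distrib power_divide)
        qed
        moreover have "j < 8 * 2 ^ m"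
        proof -
          have "t < 8" using t(2) pi_less_4 by linarith
          then have "t * 2 ^ m < 8 * 2 ^ m" by simp
          then have "real j < 8 * 2 ^ m" using j(1) by linarith
          then have "real j < real (8 * 2 ^ m)" by simp
          then show ?thesis by (simp only: of_nat_less_iff)
        qed
        ultimately have "j \<in> J m" using r(2) by (auto simp: J_def)
        then show "z \<in> (\<Union>m. W m)" using tj z t(3) by (auto simp: W_def)
      qed
    qed
    have lim: "(\<lambda>m. measure \<mu> (W m)) \<longlonglongrightarrow> measure \<mu> E"
      using finite_Lim_measure_incseq[of W] W_sets inc UN by auto
    define \<delta>0 where "\<delta>0 = 1 / (4 * C ^ 4)"
    have "0 < \<delta>0" using C1 by (simp add: \<delta>0_def)
    then obtain m0 where m0: "(1 / 2) ^ m0 < \<delta>0" using real_arch_pow_inv[of \<delta>0 "1/2"] by auto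
    have "measure \<mu> (W m) \<le> L * e" if m: "m0 \<le> m" for m
    proof -
      define \<delta> :: real where "\<delta> = (1 / 2) ^ m"
      have "\<delta> \<le> (1 / 2) ^ m0" unfolding \<delta>_def using m by (intro power_decreasing) auto
      then have "\<delta> \<le> \<delta>0" using m0 by linarith
      moreover have "0 < \<delta>" by (simp add: \<delta>_def)
      ultimately have \<delta>: "0 < \<delta>" "\<delta> \<le> \<delta>0" by auto
      then have \<delta>C: "4 * C ^ 4 * \<delta> \<le> 1" using C1 by (simp add: \<delta>0_def field_simps)
      \<comment> \<open>A nonempty piece contains a point of \<open>good_set C\<close>, and the ball
        of radius 2^-m around that point covers the whole arc because chords are no longer than
        arcs.\<close>
      have arc: "measure \<mu> (E \<inter> cis ` dyadic m j) \<le> L * \<delta>" for j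
      proof (cases "E \<inter> cis ` dyadic m j = {}")
        case True
        then show ?thesis using L0 \<delta> by simp
      next
        case False
        then obtain s where s: "cis s \<in> E" "s \<in> dyadic m j" by auto
        have g: "cis s \<in> good_set C" using s E(2) by auto
        have sub: "E \<inter> cis ` dyadic m j \<subseteq> cball (cis s) \<delta> \<inter> unit_circle"
        proof
          fix x assume "x \<in> E \<inter> cis ` dyadic m j"
          then obtain t where t: "x = cis t" "t \<in> dyadic m j" by auto
          have "\<bar>s - t\<bar> \<le> (real j + 1) / 2 ^ m - real j / 2 ^ m"
            using s(2) t(2) unfolding dyadic_def by auto
          then have "\<bar>s - t\<bar> \<le> \<delta>" by (simp add: \<delta>_def add_divide_distrib power_divide)
          then have "dist (cis s) (cis t) \<le> \<delta>"
            using cmod_cis_diff_le[of s t] by (simp add: dist_norm)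
          then show "x \<in> cball (cis s) \<delta> \<inter> unit_circle" using t(1) by simp
        qed
        have "cball (cis s) \<delta> \<inter> unit_circle \<in> sets \<mu>"
          unfolding sets_mu by (auto simp: sets_restrict_space Int_commute)
        then have "measure \<mu> (E \<inter> cis ` dyadic m j) \<le> measure \<mu> (cball (cis s) \<delta> \<inter> unit_circle)"
          using sub by (intro finite_measure_mono)
        also have "\<dots> \<le> L * \<delta>"
          unfolding L_def using g \<delta>(1) \<delta>C by (intro measure_cball_le) (auto simp: good_set_def)
        finally show ?thesis .
      qed
      have "measure \<mu> (W m) \<le> (\<Sum>j\<in>J m. measure \<mu> (E \<inter> cis ` dyadic m j))"
        unfolding W_def using J arc_sets by (intro finite_measure_subadditive_finite) auto
      also have "\<dots> \<le> real (card (J m)) * (L * \<delta>)" by (rule sum_bounded_above) (rule arc)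
      also have "\<dots> = L * (real (card (J m)) * (1 / 2 ^ m))" by (simp add: \<delta>_def power_divide)
      also have "\<dots> \<le> L * e"
        using card_dyadic_le[OF U(1) Ue _ J, of m m] e L0
        by (intro mult_left_mono) (auto simp: J_def)
      finally show ?thesis .
    qed
    then show ?thesis by (intro LIMSEQ_le_const2[OF lim]) blast
  qed
  have "measure \<mu> E \<le> 0 + e" if "0 < e" for e
  proof -
    have L0: "0 \<le> L" by (simp add: L_def zero_le_even_power)
    \<comment> \<open>Dividing by \<open>L + 1\<close> avoids the case \<open>L = 0\<close>.\<close>
    have "measure \<mu> E \<le> L * (e / (L + 1))" using that L0 by (intro bound) auto
    also have "\<dots> \<le> e" using that L0 by (simp add: field_simps)
    finally show ?thesis by simp
  qed
  then have "measure \<mu> E \<le> 0" by (rule field_le_epsilon)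
  then show ?thesis using measure_nonneg[of \<mu> E] by (simp add: emeasure_eq_measure)
qed

lemma singular_part_supported_by_unbounded_points:
  "supported_by (singular_part circle_lebesgue \<mu>)
    {z. cmod z = 1 \<and> \<not> (bounded_sol (verblunsky \<mu>) z \<and> bounded_sol (\<lambda>n. - verblunsky \<mu> n) z)}"
proof -
  define A where "A = (\<Union>k::nat. good_set (real k))"
  have As: "A \<in> sets \<mu>" unfolding A_def using good_set_sets by auto
  have A_eq: "A = {z. cmod z = 1 \<and> bounded_sol (verblunsky \<mu>) z \<and> bounded_sol (\<lambda>n. - verblunsky \<mu> n) z}"
  proof (intro equalityI subsetI)
    fix z assume "z \<in> {z. cmod z = 1 \<and> bounded_sol (verblunsky \<mu>) z \<and> bounded_sol (\<lambda>n. - verblunsky \<mu> n) z}"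
    then obtain C D where z: "cmod z = 1" "\<And>n. cmod (szego_sol (verblunsky \<mu>) z n) \<le> C"
      "\<And>n. cmod (szego_sol (\<lambda>n. - verblunsky \<mu> n) z n) \<le> D" by (auto simp: bounded_sol_def)
    obtain k :: nat where "max C D \<le> real k" using real_arch_simple by blast
    then have "z \<in> good_set (real k)"
      unfolding good_set_def using z by (auto intro: order_trans)
    then show "z \<in> A" by (auto simp: A_def)
  qed (auto simp: A_def good_set_def bounded_sol_def)
  have ac: "emeasure \<mu> E = 0" if E: "E \<in> null_sets circle_lebesgue" "E \<subseteq> A" for E
  proof -
    have Es: "E \<in> sets \<mu>" using E(1) by (auto simp: null_sets_def sets_circle_lebesgue)
    have "E \<inter> good_set (real k) \<in> null_sets \<mu>" for k :: nat
    proof -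
      have "E \<inter> good_set (real k) \<in> null_sets circle_lebesgue"
        using E(1) good_set_sets[of "real k"] by (intro null_set_Int2) (simp_all add: sets_circle_lebesgue)
      then show ?thesis
        using null_subset_good_set[of "E \<inter> good_set (real k)" "real k"] Es good_set_sets by (auto simp: null_sets_def)
    qed
    then have "(\<Union>k::nat. E \<inter> good_set (real k)) \<in> null_sets \<mu>" by (rule null_sets_UN)
    moreover have "(\<Union>k::nat. E \<inter> good_set (real k)) = E" using E(2) by (auto simp: A_def)
    ultimately show ?thesis by auto
  qed
  have "space \<mu> - A = {z. cmod z = 1 \<and> \<not> (bounded_sol (verblunsky \<mu>) z \<and> bounded_sol (\<lambda>n. - verblunsky \<mu> n) z)}"
    unfolding A_eq space_mu by auto
  then show ?thesis
    using singular_part_supported_by[OF finite_measure_axioms sets_circle_lebesgue As ac] by simp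
qed

end

theorem theorem1p1:
  fixes \<gamma> :: real and \<mu> :: "complex measure" and N :: "complex^2^2 \<Rightarrow> real"
  assumes "0 < \<gamma>" and "\<gamma> < 1"
    and "nontrivial_circle_measure \<mu>"
    and "summable (\<lambda>n. real n powr \<gamma> * (cmod (verblunsky \<mu> n))\<^sup>2)"
    and "is_matrix_norm N"
  shows "(\<exists>S. S \<subseteq> unit_circle \<and> hausdorff_dim S \<le> ennreal (2 * (1 - \<gamma>)) \<and>
            (\<forall>z \<in> unit_circle - S. bdd_above (range (\<lambda>n. N (szego_matrix \<mu> n z))))) \<and>
         (\<exists>S. S \<subseteq> unit_circle \<and> hausdorff_dim S \<le> ennreal (2 * (1 - \<gamma>)) \<and>
            supported_by (singular_part circle_lebesgue \<mu>) S)"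
proof -
  interpret circle_measure \<mu> by unfold_locales fact
  define S where "S = {z. cmod z = 1 \<and>
    \<not> (bounded_sol (verblunsky \<mu>) z \<and> bounded_sol (\<lambda>n. - verblunsky \<mu> n) z)}"
  have "S \<subseteq> unit_circle" by (auto simp: S_def)
  moreover have "hausdorff_dim S \<le> ennreal (2 * (1 - \<gamma>))"
    unfolding S_def by (rule hausdorff_dim_unbounded_sol[OF norm_verblunsky_less_1 assms(1,2,4)])
  moreover have "\<forall>z \<in> unit_circle - S. bdd_above (range (\<lambda>n. N (szego_matrix \<mu> n z)))"
    using szego_matrix_bounded[OF assms(5)] by (auto simp: S_def)
  moreover have "supported_by (singular_part circle_lebesgue \<mu>) S"
    unfolding S_def by (rule singular_part_supported_by_unbounded_points)
  ultimately show ?thesis by blast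
qed

end
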